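(* Let $S$ be a soup can or a conical cup, and let $A\ne B$ be respective points on the side and lid of $S$. (i) If $A$ and $B$ are both axial, then for each non-axial point $Q$ of $S$ there is a minimal path from $A$ to $B$ in $\Gamma_Q$. (ii) If exactly one of $A,B$ is non-axial, call it $Q$; then there is a unique minimal path from $A$ to $B$ in $\Gamma_Q$. (iii) Suppose $A$ and $B$ are non-axial and separated by the rim $T$ of the lid. Position $S$ so that $A$ has cylindrical angle $0$ and $B$ has cylindrical angle $\theta$, where $\theta\in[0,\pi]$ is the angle between $\Gamma_A$ and $\Gamma_B$. Let $h$ be the height of $S$, let $b$ be the distance from $B$ to the axis, and for $t\in[0,\theta]$ let $P=P[1,t,h]\in T$ be the rim point with cylindrical angle $t$, let $\gamma_1$ be the classical distance-minimizing geodesic on the side from $A$ to $P$, and let $\gamma_2=\overline{PB}$ be the line segment on the lid. Put $\ell(t)=\mathrm{length}(\gamma_1\cup\gamma_2)$. (a) If $S$ is a conical cup with slant height $s$ and $a$ is the distance from $A$ to the cone point, then $$\ell(t)=\sqrt{a^2-2as\cos(t/s)+s^2}+\sqrt{b^2-2b\cos(\theta-t)+1}.$$ (b) If $S$ is a soup can and $a$ is the distance from $A$ to the rim $T$, then $$\ell(t)=\sqrt{a^2+t^2}+\sqrt{b^2-2b\cos(\theta-t)+1}.$$ In either case, $\ell$ is minimized at some $t_1\in[0,\theta]$, and a path $\gamma_1\cup\gamma_2$ of length $\ell(t_1)$ is a minimal path on $S$ from $A$ to $B$.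
   Context: A soup can of height $h>0$ is the closed surface $S\subset\mathbb{R}^3$ which in cylindrical coordinates $[r,\vartheta,z]$ is the union of the side $\{r=1,\ 0\le z\le h\}$, the lid $\{r\le 1,\ z=h\}$ and the base $\{r\le 1,\ z=0\}$; the rims are the boundary circles of lid and base. A conical cup with cone angle $\phi\in(0,\pi/2)$ and slant height $s=\csc\phi>1$ is the closed surface consisting of the side $\{r=z\tan\phi,\ 0\le z\le h\}$ and the lid $\{r\le 1,\ z=h\}$, where $h=\cot\phi$; its rim is the boundary circle of the lid and its cone point is the origin. Axial points of $S$ are those on its axis of revolution $r=0$. For a non-axial point $P$, $\Gamma_P$ is the closed half-plane containing $P$ and bounded by the axis. If $U$ is the lid and $T=\partial U$, then $A$ and $B$ are separated by $T$ if one of them lies in $S-U$ and the other in $U-T$. A path on $S$ from $A$ to $B$ is a continuous map $\gamma:[a',b']\to S$ with $\gamma(a')=A$, $\gamma(b')=B$; it is minimal if its length is at most that of every path on $S$ from $A$ to $B$. Paths are identified with their images, so uniqueness is up to reparametrization. A classical distance-minimizing geodesic on the side is a shortest path among paths lying on the side. *)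

theory Defs
  imports "HOL-Analysis.Analysis"
begin

type_synonym point = "real^3"

definition cyl :: "real \<Rightarrow> real \<Rightarrow> real \<Rightarrow> point" where
  "cyl r t z = vector [r * cos t, r * sin t, z]"

definition radius :: "point \<Rightarrow> real" where
  "radius X = sqrt ((X$1)\<^sup>2 + (X$2)\<^sup>2)"

definition revolution_axis :: "point set" where
  "revolution_axis = {X. radius X = 0}"

abbreviation axial :: "point \<Rightarrow> bool" where
  "axial X \<equiv> X \<in> revolution_axis"

(* SoupCan h has height h; ConicalCup phi has cone angle phi (between the axis and the side),
   hence lid radius 1, height cot phi and slant height csc phi = 1 / sin phi. *)
datatype vessel = SoupCan real | ConicalCup real

fun is_vessel :: "vessel \<Rightarrow> bool" where
  "is_vessel (SoupCan h) \<longleftrightarrow> h > 0"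
| "is_vessel (ConicalCup \<phi>) \<longleftrightarrow> 0 < \<phi> \<and> \<phi> < pi / 2"

fun height :: "vessel \<Rightarrow> real" where
  "height (SoupCan h) = h"
| "height (ConicalCup \<phi>) = cot \<phi>"

fun side :: "vessel \<Rightarrow> point set" where
  "side (SoupCan h) = {X. radius X = 1 \<and> 0 \<le> X$3 \<and> X$3 \<le> h}"
| "side (ConicalCup \<phi>) = {X. radius X = X$3 * tan \<phi> \<and> 0 \<le> X$3 \<and> X$3 \<le> cot \<phi>}"

definition lid :: "vessel \<Rightarrow> point set" where
  "lid V = {X. radius X \<le> 1 \<and> X$3 = height V}"

fun base :: "vessel \<Rightarrow> point set" where
  "base (SoupCan h) = {X. radius X \<le> 1 \<and> X$3 = 0}"
| "base (ConicalCup \<phi>) = {}"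

definition rim :: "vessel \<Rightarrow> point set" where
  "rim V = {X. radius X = 1 \<and> X$3 = height V}"

definition surface :: "vessel \<Rightarrow> point set" where
  "surface V = side V \<union> lid V \<union> base V"

(* Intended for non-axial P only. *)
definition half_plane :: "point \<Rightarrow> point set" where
  "half_plane P = {X. \<exists>c\<ge>0. X$1 = c * P$1 \<and> X$2 = c * P$2}"

(* For non-axial A and B: the angle in [0, pi] between half_plane A and half_plane B, i.e.
   between the horizontal projections of A and B. *)
definition half_plane_angle :: "point \<Rightarrow> point \<Rightarrow> real" where
  "half_plane_angle A B = arccos ((A$1 * B$1 + A$2 * B$2) / (radius A * radius B))"

definition separated_by_rim :: "vessel \<Rightarrow> point \<Rightarrow> point \<Rightarrow> bool" where
  "separated_by_rim V A B \<longleftrightarrow>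
     A \<in> surface V - lid V \<and> B \<in> lid V - rim V \<or>
     B \<in> surface V - lid V \<and> A \<in> lid V - rim V"

(* Supremum of the lengths of inscribed polygons, infinite for a non-rectifiable path. *)
definition path_length :: "(real \<Rightarrow> 'a::metric_space) \<Rightarrow> ennreal" where
  "path_length \<gamma> =
     (SUP (n, p) \<in> {(n::nat, p::nat \<Rightarrow> real). mono p \<and> range p \<subseteq> {0..1}}.
        \<Sum>i<n. ennreal (dist (\<gamma> (p i)) (\<gamma> (p (Suc i)))))"

definition path_from_to :: "'a::metric_space set \<Rightarrow> 'a \<Rightarrow> 'a \<Rightarrow> (real \<Rightarrow> 'a) \<Rightarrow> bool" where
  "path_from_to M A B \<gamma> \<longleftrightarrow>
     path \<gamma> \<and> path_image \<gamma> \<subseteq> M \<and> pathstart \<gamma> = A \<and> pathfinish \<gamma> = B"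

(* With M the whole surface this is a minimal path; with M the side it is a classical
   distance-minimizing geodesic on the side. *)
definition minimal_path :: "'a::metric_space set \<Rightarrow> 'a \<Rightarrow> 'a \<Rightarrow> (real \<Rightarrow> 'a) \<Rightarrow> bool" where
  "minimal_path M A B \<gamma> \<longleftrightarrow>
     path_from_to M A B \<gamma> \<and>
     (\<forall>\<gamma>'. path_from_to M A B \<gamma>' \<longrightarrow> path_length \<gamma> \<le> path_length \<gamma>')"

(* rho is a rotation about the axis or a reflection in a plane through it, and the point with
   cylindrical coordinates [r, t, z] in the frame rho is rho (cyl r t z). Choosing a frame is
   how the surface is positioned relative to the coordinates: A gets angle 0, B angle theta. *)
definition positioning :: "(point \<Rightarrow> point) \<Rightarrow> real \<Rightarrow> point \<Rightarrow> point \<Rightarrow> bool" where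
  "positioning \<rho> \<theta> A B \<longleftrightarrow>
     orthogonal_transformation \<rho> \<and> (\<forall>X\<in>revolution_axis. \<rho> X = X) \<and>
     A = \<rho> (cyl (radius A) 0 (A$3)) \<and> B = \<rho> (cyl (radius B) \<theta> (B$3))"

end

(*
  Unrolling the side (cylinder or cone) turns side paths into plane curves. No covering map is
  needed: the unrolled distance D is a pseudometric on the side that agrees with the ambient
  distance up to a factor 1 + epsilon at small scale, so summing over a fine partition bounds the
  length of a path on the side from below by D of its endpoints; on the cone this requires staying
  away from the cone point, and a path through the cone point is long for trivial reasons.

  A path from A to B reaches the rim for the first time at some R, and the remainder is at
  least the chord RB. On a cone or a can whose base is not used, the part up to R costs at least the
  unrolled distance from A to R. A path visiting the base of a can costs at least two side
  arcs and a chord of the base; rotating that chord about the axis moves it to the lid, at the same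
  cost. The triangle inequality for angles then brings the crossing angle into [0, theta].
*)
theory Submission
  imports Defs
begin

section \<open>Length of paths\<close>

text \<open>Angles enter the unrolled distances only as \<open>half_plane_angle\<close>, which never
  exceeds pi. This avoids lifting a path to a winding angle; the price is paid in the triangle
  inequality. On the can it is low, since the unrolled distance grows with the angle without bound.
  On the cone the sum of two scaled angles may pass pi, where the cosine law decreases again; what
  saves the inequality is that the three angles between three directions add up to at most 2 pi. On
  a can the two side arcs of a base detour may also add up to more than pi, so the length of the
  side leg is kept as a function of an unrestricted angle there. The lower bound yields some
  crossing angle in [0, \<theta>], not the best one; a minimizer of the length function absorbs the
  difference. When \<open>A\<close> or \<open>B\<close> is axial nothing is unrolled: straight
  distances to the rim already match the lengths of segments in one half-plane.\<close>

definition arc_length :: "(real \<Rightarrow> 'a::metric_space) \<Rightarrow> real \<Rightarrow> real \<Rightarrow> ennreal" where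
  "arc_length \<gamma> a b =
     (SUP (n, p) \<in> {(n::nat, p::nat \<Rightarrow> real). mono p \<and> range p \<subseteq> {a..b}}.
        \<Sum>i<n. ennreal (dist (\<gamma> (p i)) (\<gamma> (p (Suc i)))))"

lemma path_length_eq_arc_length: "path_length \<gamma> = arc_length \<gamma> 0 1"
  by (simp add: path_length_def arc_length_def)

lemma sum_dist_le_arc_length:
  assumes "mono p" "range p \<subseteq> {a..b}"
  shows "(\<Sum>i<n. ennreal (dist (\<gamma> (p i)) (\<gamma> (p (Suc i))))) \<le> arc_length \<gamma> a b"
  unfolding arc_length_def by (rule SUP_upper2[where i = "(n, p)"]) (use assms in auto)

lemma arc_length_le:
  assumes "\<And>n p. mono p \<Longrightarrow> range p \<subseteq> {a..b} \<Longrightarrow>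
     (\<Sum>i<n. ennreal (dist (\<gamma> (p i)) (\<gamma> (p (Suc i))))) \<le> L"
  shows "arc_length \<gamma> a b \<le> L"
  unfolding arc_length_def by (rule SUP_least) (use assms in auto)

lemma dist_le_arc_length:
  assumes "a \<le> b"
  shows "ennreal (dist (\<gamma> a) (\<gamma> b)) \<le> arc_length \<gamma> a b"
proof -
  define p :: "nat \<Rightarrow> real" where "p = (\<lambda>i. if i = 0 then a else b)"
  have "mono p" "range p \<subseteq> {a..b}"
    using assms by (auto simp: p_def mono_def)
  from sum_dist_le_arc_length[OF this, where n = 1 and \<gamma> = \<gamma>] show ?thesis
    by (simp add: p_def)
qed

text \<open>Partitions of the two subintervals are concatenated, which bounds every sum of two
  inscribed lengths; the two suprema are then taken one after the other, over index sets that are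
  nonempty.\<close>

lemma arc_length_add_le:
  assumes "a \<le> b" "b \<le> c"
  shows "arc_length \<gamma> a b + arc_length \<gamma> b c \<le> arc_length \<gamma> a c"
proof -
  let ?s = "\<lambda>(n::nat, p::nat \<Rightarrow> real). \<Sum>i<n. ennreal (dist (\<gamma> (p i)) (\<gamma> (p (Suc i))))"
  let ?I = "\<lambda>a b. {(n::nat, p::nat \<Rightarrow> real). mono p \<and> range p \<subseteq> {a..b}}"
  have ne: "?I u v \<noteq> {}" if "u \<le> v" for u v :: real
    using that by (auto intro!: exI[of _ "\<lambda>_. u"] simp: mono_def)
  have join: "?s np + ?s mq \<le> arc_length \<gamma> a c" if np: "np \<in> ?I a b" and mq: "mq \<in> ?I b c" for np mq
  proof -
    obtain n p m q where [simp]: "np = (n, p)" "mq = (m, q)" by (metis surj_pair)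
    have p: "mono p" "\<And>i. p i \<in> {a..b}" and q: "mono q" "\<And>i. q i \<in> {b..c}"
      using np mq by (auto dest: subsetD[OF _ rangeI])
    \<comment> \<open>Indices up to \<open>n\<close> run through \<open>p\<close>, later ones
      through \<open>q\<close> shifted by \<open>Suc n\<close>. The step from \<open>n\<close> to
      \<open>Suc n\<close> bridges the two partitions and is dropped in the comparison.\<close>
    define r where "r i = (if i \<le> n then p i else q (i - Suc n))" for i
    have pq: "p i \<le> q j" for i j
      using p(2)[of i] q(2)[of j] by auto
    have "mono r"
      using p(1) q(1) pq by (auto simp: mono_def r_def)
    moreover have "r i \<in> {a..c}" for i
      using p(2)[of i] q(2)[of "i - Suc n"] assms by (auto simp: r_def)
    ultimately have le: "?s (Suc n + m, r) \<le> arc_length \<gamma> a c"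
      unfolding prod.case by (intro sum_dist_le_arc_length) auto
    let ?d = "\<lambda>i. ennreal (dist (\<gamma> (r i)) (\<gamma> (r (Suc i))))"
    have split: "(\<Sum>i<Suc n + m. f i) = (\<Sum>i<Suc n. f i) + (\<Sum>i<m. f (Suc n + i))"
      for f :: "nat \<Rightarrow> ennreal"
      by (induction m) (auto simp: add.assoc)
    have "?s np = (\<Sum>i<n. ?d i)"
      by (auto simp: r_def intro!: sum.cong)
    moreover have "?s mq = (\<Sum>i<m. ?d (Suc n + i))"
      by (auto simp: r_def intro!: sum.cong)
    ultimately have "?s np + ?s mq \<le> (\<Sum>i<Suc n. ?d i) + (\<Sum>i<m. ?d (Suc n + i))"
      by (simp del: sum_ennreal add: add_right_mono)
    also have "\<dots> = ?s (Suc n + m, r)"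
      unfolding prod.case by (rule split[symmetric])
    finally have "?s np + ?s mq \<le> ?s (Suc n + m, r)" .
    with le show ?thesis by (rule order_trans[rotated])
  qed
  have "?s np + arc_length \<gamma> b c \<le> arc_length \<gamma> a c" if np: "np \<in> ?I a b" for np
  proof -
    have "?s np + arc_length \<gamma> b c = (SUP mq\<in>?I b c. ?s np + ?s mq)"
      unfolding arc_length_def using ne[OF assms(2)]
      by (subst ennreal_SUP_add_right) (auto simp: case_prod_unfold)
    also have "\<dots> \<le> arc_length \<gamma> a c"
      using np join by (intro SUP_least) blast
    finally show ?thesis .
  qed
  moreover have "arc_length \<gamma> a b + arc_length \<gamma> b c = (SUP np\<in>?I a b. ?s np + arc_length \<gamma> b c)"
    using ennreal_SUP_add_left[OF ne[OF assms(1)], of ?s "arc_length \<gamma> b c"]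
    by (simp add: arc_length_def)
  ultimately show ?thesis
    by (auto intro!: SUP_least)
qed

text \<open>A partition of the whole interval is clipped at \<open>b\<close> from above and from
  below. A step across \<open>b\<close> is split there by the triangle inequality; any other step
  survives in one clipped partition and degenerates in the other.\<close>

lemma arc_length_le_add:
  assumes "a \<le> b" "b \<le> c"
  shows "arc_length \<gamma> a c \<le> arc_length \<gamma> a b + arc_length \<gamma> b c"
proof (rule arc_length_le)
  fix n :: nat and p :: "nat \<Rightarrow> real"
  assume p: "mono p" "range p \<subseteq> {a..c}"
  define q r where "q i = min (p i) b" and "r i = max (p i) b" for i
  have ac: "p i \<in> {a..c}" for i using p(2) by blast
  have pm: "p i \<le> p (Suc i)" for i using p(1) by (simp add: monoD)
  have q: "mono q" "range q \<subseteq> {a..b}" and r: "mono r" "range r \<subseteq> {b..c}"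
    using p(1) ac assms
    by (auto simp: mono_def q_def r_def min_def max_def dest: order_trans)
  have "dist (\<gamma> (p i)) (\<gamma> (p (Suc i))) \<le>
          dist (\<gamma> (q i)) (\<gamma> (q (Suc i))) + dist (\<gamma> (r i)) (\<gamma> (r (Suc i)))" for i
    using pm[of i] dist_triangle[of "\<gamma> (p i)" "\<gamma> (p (Suc i))" "\<gamma> b"]
    by (auto simp: q_def r_def min_def max_def)
  hence "(\<Sum>i<n. ennreal (dist (\<gamma> (p i)) (\<gamma> (p (Suc i))))) \<le>
     (\<Sum>i<n. ennreal (dist (\<gamma> (q i)) (\<gamma> (q (Suc i)))) + ennreal (dist (\<gamma> (r i)) (\<gamma> (r (Suc i)))))"
    by (intro sum_mono) (simp flip: ennreal_plus)
  also have "\<dots> \<le> arc_length \<gamma> a b + arc_length \<gamma> b c"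
    unfolding sum.distrib by (intro add_mono sum_dist_le_arc_length q r)
  finally show "(\<Sum>i<n. ennreal (dist (\<gamma> (p i)) (\<gamma> (p (Suc i))))) \<le> arc_length \<gamma> a b + arc_length \<gamma> b c" .
qed

lemma arc_length_add:
  assumes "a \<le> b" "b \<le> c"
  shows "arc_length \<gamma> a c = arc_length \<gamma> a b + arc_length \<gamma> b c"
  using arc_length_add_le[OF assms] arc_length_le_add[OF assms] by (rule order_antisym[rotated])

lemma arc_length_le_affine:
  assumes "m > 0" and "\<And>x. x \<in> {a..b} \<Longrightarrow> \<delta> x = \<gamma> (m * x + c)"
  shows "arc_length \<delta> a b \<le> arc_length \<gamma> (m * a + c) (m * b + c)"
proof (rule arc_length_le)
  fix n :: nat and p :: "nat \<Rightarrow> real"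
  assume p: "mono p" "range p \<subseteq> {a..b}"
  have eq: "\<delta> (p i) = \<gamma> (m * p i + c)" for i
    using p(2) by (intro assms) blast
  have "mono (\<lambda>i. m * p i + c)" "range (\<lambda>i. m * p i + c) \<subseteq> {m * a + c..m * b + c}"
    using p assms(1) by (auto simp: mono_def)
  from sum_dist_le_arc_length[OF this, where n = n and \<gamma> = \<gamma>]
  show "(\<Sum>i<n. ennreal (dist (\<delta> (p i)) (\<delta> (p (Suc i))))) \<le> arc_length \<gamma> (m * a + c) (m * b + c)"
    by (simp add: eq)
qed

lemma arc_length_affine:
  assumes m: "m > 0" and eq: "\<And>x. x \<in> {a..b} \<Longrightarrow> \<delta> x = \<gamma> (m * x + c)"
  shows "arc_length \<delta> a b = arc_length \<gamma> (m * a + c) (m * b + c)"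
proof (rule order_antisym)
  show "arc_length \<delta> a b \<le> arc_length \<gamma> (m * a + c) (m * b + c)"
    using assms by (rule arc_length_le_affine)
  have "arc_length \<gamma> (m * a + c) (m * b + c) \<le>
     arc_length \<delta> ((1 / m) * (m * a + c) + (- c / m)) ((1 / m) * (m * b + c) + (- c / m))"
  proof (rule arc_length_le_affine)
    fix x assume x: "x \<in> {m * a + c..m * b + c}"
    have "1 / m * x + - c / m \<in> {a..b}"
      using x m by (auto simp: field_simps)
    from eq[OF this] show "\<gamma> x = \<delta> (1 / m * x + - c / m)"
      using m by (simp add: field_simps)
  qed (use m in simp)
  thus "arc_length \<gamma> (m * a + c) (m * b + c) \<le> arc_length \<delta> a b"
    using m by (simp add: field_simps)
qed

lemma path_length_joinpaths:
  assumes "pathfinish \<gamma> = pathstart \<delta>"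
  shows "path_length (\<gamma> +++ \<delta>) = path_length \<gamma> + path_length \<delta>"
proof -
  have "path_length (\<gamma> +++ \<delta>) = arc_length (\<gamma> +++ \<delta>) 0 (1/2) + arc_length (\<gamma> +++ \<delta>) (1/2) 1"
    unfolding path_length_eq_arc_length by (rule arc_length_add) auto
  also have "arc_length (\<gamma> +++ \<delta>) 0 (1/2) = arc_length \<gamma> (2 * 0 + 0) (2 * (1/2) + 0)"
    by (rule arc_length_affine) (auto simp: joinpaths_def)
  also have "arc_length (\<gamma> +++ \<delta>) (1/2) 1 = arc_length \<delta> (2 * (1/2) + (-1)) (2 * 1 + (-1))"
  proof (rule arc_length_affine)
    fix x :: real assume "x \<in> {1/2..1}"
    \<comment> \<open>At the midpoint \<open>joinpaths\<close> takes its value from the first path,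
      so only the matching of the endpoints identifies it with the second.\<close>
    hence "x = 1/2 \<or> x > 1/2" by auto
    thus "(\<gamma> +++ \<delta>) x = \<delta> (2 * x + -1)"
    proof
      assume x: "x = 1/2"
      show ?thesis
        using assms unfolding x by (simp add: joinpaths_def pathstart_def pathfinish_def)
    qed (simp add: joinpaths_def)
  qed auto
  finally show ?thesis
    by (simp add: path_length_eq_arc_length)
qed

lemma path_length_lipschitz_le:
  assumes "L \<ge> 0" and lip: "\<And>x y. x \<in> {0..1} \<Longrightarrow> y \<in> {0..1} \<Longrightarrow> x \<le> y \<Longrightarrow> dist (\<gamma> x) (\<gamma> y) \<le> L * (y - x)"
  shows "path_length \<gamma> \<le> ennreal L"
  unfolding path_length_eq_arc_length
proof (rule arc_length_le)
  fix n :: nat and p :: "nat \<Rightarrow> real"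
  assume p: "mono p" "range p \<subseteq> {0..1}"
  have p01: "p i \<in> {0..1}" for i using p(2) by blast
  have "(\<Sum>i<n. ennreal (dist (\<gamma> (p i)) (\<gamma> (p (Suc i))))) \<le> (\<Sum>i<n. ennreal (L * (p (Suc i) - p i)))"
    using p01 p(1) by (intro sum_mono ennreal_leI lip) (auto simp: mono_def)
  also have "\<dots> = ennreal (\<Sum>i<n. L * (p (Suc i) - p i))"
    using p(1) assms(1) by (intro sum_ennreal) (simp add: monoD)
  also have "(\<Sum>i<n. L * (p (Suc i) - p i)) = L * (p n - p 0)"
    by (simp add: sum_lessThan_telescope flip: sum_distrib_left)
  also have "ennreal \<dots> \<le> ennreal (L * 1)"
    using p01[of n] p01[of 0] assms(1) by (intro ennreal_leI mult_left_mono) auto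
  finally show "(\<Sum>i<n. ennreal (dist (\<gamma> (p i)) (\<gamma> (p (Suc i))))) \<le> ennreal L" by simp
qed

lemma path_length_linepath: "path_length (linepath a b) = ennreal (dist a b)"
proof (rule order_antisym)
  show "path_length (linepath a b) \<le> ennreal (dist a b)"
  proof (rule path_length_lipschitz_le)
    fix x y :: real assume "x \<le> y"
    have "linepath a b x - linepath a b y = (y - x) *\<^sub>R (a - b)"
      by (simp add: linepath_def algebra_simps)
    thus "dist (linepath a b x) (linepath a b y) \<le> dist a b * (y - x)"
      using \<open>x \<le> y\<close> by (simp add: dist_norm)
  qed simp
  show "ennreal (dist a b) \<le> path_length (linepath a b)"
    using dist_le_arc_length[of 0 1 "linepath a b"] by (simp add: path_length_eq_arc_length linepath_def)
qed

text \<open>A fine partition of the path turns the infinitesimal comparison of \<open>D\<close> with the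
  ambient distance into the global one.\<close>

lemma arc_length_ge_calibration:
  fixes \<gamma> :: "real \<Rightarrow> 'a::metric_space" and D :: "'a \<Rightarrow> 'a \<Rightarrow> real"
  assumes "a \<le> b" and cont: "continuous_on {a..b} \<gamma>" and K: "\<gamma> ` {a..b} \<subseteq> K"
    and zero: "\<And>x. x \<in> K \<Longrightarrow> D x x = 0"
    and tri: "\<And>x y z. x \<in> K \<Longrightarrow> y \<in> K \<Longrightarrow> z \<in> K \<Longrightarrow> D x z \<le> D x y + D y z"
    and loc: "\<And>\<epsilon>. \<epsilon> > 0 \<Longrightarrow> \<exists>\<eta>>0. \<forall>x\<in>K. \<forall>y\<in>K. dist x y < \<eta> \<longrightarrow> D x y \<le> (1 + \<epsilon>) * dist x y"
  shows "ennreal (D (\<gamma> a) (\<gamma> b)) \<le> arc_length \<gamma> a b"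
proof (cases "arc_length \<gamma> a b = \<infinity>")
  case False
  then obtain L where L: "arc_length \<gamma> a b = ennreal L" "L \<ge> 0"
    by (cases "arc_length \<gamma> a b") auto
  have bound: "D (\<gamma> a) (\<gamma> b) \<le> (1 + \<epsilon>) * L" if \<epsilon>: "\<epsilon> > 0" for \<epsilon>
  proof -
    obtain \<eta> where \<eta>: "\<eta> > 0" "\<And>x y. x \<in> K \<Longrightarrow> y \<in> K \<Longrightarrow> dist x y < \<eta> \<Longrightarrow> D x y \<le> (1 + \<epsilon>) * dist x y"
      using loc[OF \<epsilon>] by metis
    have "uniformly_continuous_on {a..b} \<gamma>"
      using cont by (intro compact_uniformly_continuous) auto
    then obtain \<zeta> where \<zeta>: "\<zeta> > 0"
      "\<And>x y. x \<in> {a..b} \<Longrightarrow> y \<in> {a..b} \<Longrightarrow> dist x y < \<zeta> \<Longrightarrow> dist (\<gamma> x) (\<gamma> y) < \<eta>"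
      using \<eta>(1) unfolding uniformly_continuous_on_def by metis
    obtain n :: nat where n: "(b - a) / \<zeta> < n"
      using reals_Archimedean2 by blast
    have n0: "n > 0" using n \<open>a \<le> b\<close> \<zeta>(1)
      by (metis diff_ge_0_iff_ge divide_nonneg_pos gr0I less_eq_real_def linorder_not_less of_nat_0)
    \<comment> \<open>Equidistant points, frozen at \<open>b\<close> from index \<open>n\<close> on,
      because a partition is encoded as an infinite monotone sequence.\<close>
    define p where "p i = a + (b - a) * real (min i n) / real n" for i :: nat
    have "mono p"
      using \<open>a \<le> b\<close> by (auto simp: mono_def p_def intro!: divide_right_mono mult_left_mono)
    have p_in: "p i \<in> {a..b}" for i
    proof -
      have "(b - a) * real (min i n) / real n \<le> (b - a) * 1"
        using \<open>a \<le> b\<close> n0 by (simp add: divide_le_eq mult_left_mono)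
      thus ?thesis using \<open>a \<le> b\<close> by (auto simp: p_def)
    qed
    have step: "dist (p i) (p (Suc i)) < \<zeta>" for i
    proof -
      have "p (Suc i) - p i = (b - a) * (real (min (Suc i) n) - real (min i n)) / real n"
        by (simp add: p_def right_diff_distrib diff_divide_distrib)
      moreover have "p i \<le> p (Suc i)"
        using \<open>mono p\<close> by (simp add: monoD)
      ultimately have "dist (p i) (p (Suc i)) = (b - a) * (real (min (Suc i) n) - real (min i n)) / real n"
        by (simp add: dist_real_def)
      also have "\<dots> \<le> (b - a) * 1 / real n"
        using \<open>a \<le> b\<close> by (intro divide_right_mono mult_left_mono) auto
      also have "\<dots> < \<zeta>"
        using n n0 \<zeta>(1) by (simp add: field_simps)
      finally show ?thesis .
    qed
    have Kp: "\<gamma> (p i) \<in> K" for i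
      using K p_in by blast
    have D_sum: "D (\<gamma> (p 0)) (\<gamma> (p m)) \<le> (\<Sum>i<m. D (\<gamma> (p i)) (\<gamma> (p (Suc i))))" for m
    proof (induction m)
      case (Suc m)
      thus ?case using tri[OF Kp Kp Kp, of 0 "Suc m" m] by simp
    qed (simp add: zero[OF Kp])
    have "ennreal (\<Sum>i<n. dist (\<gamma> (p i)) (\<gamma> (p (Suc i)))) \<le> arc_length \<gamma> a b"
      using sum_dist_le_arc_length[OF \<open>mono p\<close>, where a = a and b = b and n = n and \<gamma> = \<gamma>] p_in by (simp add: image_subset_iff)
    hence sumL: "(\<Sum>i<n. dist (\<gamma> (p i)) (\<gamma> (p (Suc i)))) \<le> L"
      using L by simp
    have "D (\<gamma> a) (\<gamma> b) = D (\<gamma> (p 0)) (\<gamma> (p n))"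
      using n0 by (simp add: p_def)
    also have "\<dots> \<le> (\<Sum>i<n. D (\<gamma> (p i)) (\<gamma> (p (Suc i))))"
      by (rule D_sum)
    also have "\<dots> \<le> (\<Sum>i<n. (1 + \<epsilon>) * dist (\<gamma> (p i)) (\<gamma> (p (Suc i))))"
      by (intro sum_mono \<eta>(2) Kp \<zeta>(2) p_in step)
    also have "\<dots> \<le> (1 + \<epsilon>) * L"
      using sumL \<epsilon> by (simp flip: sum_distrib_left)
    finally show ?thesis .
  qed
  have "D (\<gamma> a) (\<gamma> b) \<le> L"
  proof (rule field_le_epsilon)
    fix e :: real assume e: "e > 0"
    \<comment> \<open>The denominator \<open>L + 1\<close> instead of \<open>L\<close> covers a path
      of length 0.\<close>
    have "e / (L + 1) * L \<le> e"
      using e L(2) by (simp add: field_simps)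
    with bound[of "e / (L + 1)"] e L(2) show "D (\<gamma> a) (\<gamma> b) \<le> L + e"
      by (simp add: algebra_simps)
  qed
  thus ?thesis
    by (simp add: L ennreal_leI)
qed simp

lemma first_time_in_closed:
  fixes \<gamma> :: "real \<Rightarrow> 'a::metric_space"
  assumes "continuous_on {a..b} \<gamma>" "closed S" "v \<in> {a..b}" "\<gamma> v \<in> S"
  obtains u where "u \<in> {a..b}" "\<gamma> u \<in> S" "\<And>w. w \<in> {a..<u} \<Longrightarrow> \<gamma> w \<notin> S"
proof -
  let ?T = "{a..b} \<inter> \<gamma> -` S"
  have "compact ?T"
    using continuous_closed_preimage[OF assms(1) _ assms(2)]
    by (simp add: compact_eq_bounded_closed bounded_Int)
  moreover have "?T \<noteq> {}" using assms by auto
  ultimately obtain u where "u \<in> ?T" "\<And>w. w \<in> ?T \<Longrightarrow> u \<le> w"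
    using compact_attains_inf by metis
  thus ?thesis
    by (intro that[of u]) force+
qed

lemma last_time_in_closed:
  fixes \<gamma> :: "real \<Rightarrow> 'a::metric_space"
  assumes "continuous_on {a..b} \<gamma>" "closed S" "v \<in> {a..b}" "\<gamma> v \<in> S"
  obtains u where "u \<in> {a..b}" "\<gamma> u \<in> S" "\<And>w. w \<in> {u<..b} \<Longrightarrow> \<gamma> w \<notin> S"
proof -
  let ?T = "{a..b} \<inter> \<gamma> -` S"
  have "compact ?T"
    using continuous_closed_preimage[OF assms(1) _ assms(2)]
    by (simp add: compact_eq_bounded_closed bounded_Int)
  moreover have "?T \<noteq> {}" using assms by auto
  ultimately obtain u where "u \<in> ?T" "\<And>w. w \<in> ?T \<Longrightarrow> w \<le> u"
    using compact_attains_sup by metis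
  moreover have "w \<in> {a..b}" if "u \<in> {a..b}" "w \<in> {u<..b}" for w
    using that by auto
  ultimately show ?thesis
    by (intro that[of u]) fastforce+
qed

section \<open>Angles and the law of cosines\<close>

text \<open>The third side of a plane triangle. It serves for chords of the lid and the base and
  equally for distances in the unrolled cone.\<close>

definition cosine_law :: "real \<Rightarrow> real \<Rightarrow> real \<Rightarrow> real" where
  "cosine_law x y t = sqrt (x\<^sup>2 + y\<^sup>2 - 2 * x * y * cos t)"

lemma cosine_law_eq_cmod: "cosine_law x y t = cmod (of_real x - of_real y * cis t)"
proof -
  have "x\<^sup>2 + y\<^sup>2 - 2 * x * y * cos t = (x - y * cos t)\<^sup>2 + (y * sin t)\<^sup>2"
    unfolding power_mult_distrib sin_squared_eq by (simp add: power2_eq_square algebra_simps)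
  thus ?thesis
    by (simp add: cosine_law_def cmod_def)
qed

lemma cosine_law_nonneg: "cosine_law x y t \<ge> 0"
  by (simp add: cosine_law_eq_cmod)

lemma cosine_law_sq: "(cosine_law x y t)\<^sup>2 = x\<^sup>2 + y\<^sup>2 - 2 * x * y * cos t"
  using cosine_law_nonneg[of x y t] by (simp add: cosine_law_def)

text \<open>Separates a radial from an angular part, so that comparing two such distances with the
  same radii reduces to comparing sines of half-angles. All local estimates below use this
  form.\<close>

lemma cosine_law_sq_half_angle: "(cosine_law x y t)\<^sup>2 = (x - y)\<^sup>2 + 4 * x * y * (sin (t / 2))\<^sup>2"
proof -
  have cos: "cos t = 1 - 2 * (sin (t / 2))\<^sup>2"
    using cos_double_sin[of "t / 2"] by simp
  show ?thesis
    unfolding cosine_law_sq cos by (simp add: power2_eq_square algebra_simps)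
qed

text \<open>The triangle inequality in the complex plane for the points \<open>x\<close>,
  \<open>y * cis s\<close> and \<open>z * cis (s + t)\<close>. The angles are arbitrary reals, so
  signed turns can be added without reduction.\<close>

lemma cosine_law_triangle: "cosine_law x z (s + t) \<le> cosine_law x y s + cosine_law y z t"
proof -
  have "cosine_law y z t = cmod (cis s * (of_real y - of_real z * cis t))"
    by (simp add: cosine_law_eq_cmod norm_mult)
  also have "cis s * (of_real y - of_real z * cis t) = of_real y * cis s - of_real z * cis (s + t)"
    by (simp add: algebra_simps flip: cis_mult)
  finally show ?thesis
    using norm_triangle_ineq[of "of_real x - of_real y * cis s" "of_real y * cis s - of_real z * cis (s + t)"]
    by (simp add: cosine_law_eq_cmod)
qed

lemma cosine_law_mono:
  assumes "x \<ge> 0" "y \<ge> 0" "cos t \<le> cos s"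
  shows "cosine_law x y s \<le> cosine_law x y t"
  using assms unfolding cosine_law_def by (simp add: mult_left_mono)

lemma cosine_law_le_add:
  assumes "x \<ge> 0" "y \<ge> 0"
  shows "cosine_law x y t \<le> x + y"
  using cosine_law_triangle[of x y t 0 0] assms by (simp add: cosine_law_def)

text \<open>Here \<open>q\<close> may lie beyond pi: reflecting it to \<open>2 * pi - q\<close>
  keeps the cosine and puts it between \<open>p\<close> and pi. The range allowed for
  \<open>q\<close> is exactly what the perimeter bound on angles provides.\<close>

lemma cos_le_cos_of_le:
  assumes "0 \<le> p" "p \<le> q" "q \<le> 2 * pi - p"
  shows "cos q \<le> cos p"
proof (cases "q \<le> pi")
  case False
  have "cos q = cos (2 * pi - q)" by simp
  also have "\<dots> \<le> cos p"
    using assms False by (intro cos_monotone_0_pi_le) auto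
  finally show ?thesis .
qed (use assms in \<open>auto intro: cos_monotone_0_pi_le\<close>)

lemma arccos_cos_bounds: "0 \<le> arccos (cos x)" "arccos (cos x) \<le> pi"
  by (auto intro: arccos_lbound arccos_ubound)

text \<open>\<open>arccos (cos x)\<close> is the distance from \<open>x\<close> to the nearest
  multiple of 2 pi, so this is the triangle inequality on the circle. If the right side is at most
  pi, its cosine is \<open>cos x * cos y - \<bar>sin x * sin y\<bar>\<close>, which is at most
  \<open>cos (x + y)\<close>; otherwise the bound pi on the left side is enough.\<close>

lemma arccos_cos_add_le: "arccos (cos (x + y)) \<le> arccos (cos x) + arccos (cos y)"
proof (cases "arccos (cos x) + arccos (cos y) \<le> pi")
  case True
  have sin: "sin (arccos (cos u)) = \<bar>sin u\<bar>" for u :: real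
    using sin_cos_squared_add[of u] by (simp add: sin_arccos_abs flip: sin_squared_eq)
  have "cos (arccos (cos x) + arccos (cos y)) = cos x * cos y - \<bar>sin x * sin y\<bar>"
    by (simp add: cos_add sin abs_mult)
  also have "\<dots> \<le> cos (x + y)"
    by (simp add: cos_add)
  finally have "arccos (cos (x + y)) \<le> arccos (cos (arccos (cos x) + arccos (cos y)))"
    by (intro arccos_le_arccos) auto
  also have "\<dots> = arccos (cos x) + arccos (cos y)"
    using True by (intro arccos_cos) (auto simp: arccos_cos_bounds)
  finally show ?thesis .
next
  case False
  thus ?thesis using arccos_cos_bounds[of "x + y"] by linarith
qed

text \<open>The triangle inequality with one vertex replaced by its antipode.\<close>

lemma arccos_cos_perimeter: "arccos (cos (x + y)) + arccos (cos x) + arccos (cos y) \<le> 2 * pi"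
proof -
  \<comment> \<open>Shifting \<open>x\<close> by pi and \<open>y\<close> by -pi turns each angle
    into its supplement and leaves the sum unchanged.\<close>
  have "arccos (cos (u + pi)) = pi - arccos (cos u)" for u
    by (simp add: arccos_minus)
  moreover have "arccos (cos (y - pi)) = pi - arccos (cos y)"
    by (simp add: arccos_minus cos_diff)
  ultimately show ?thesis
    using arccos_cos_add_le[of "x + pi" "y - pi"] by simp
qed

text \<open>Smallness is required of the sine and not of \<open>x\<close>, because a small distance
  controls only the chord. On [0, pi/2] the sine is increasing, so a small sine forces a small
  angle.\<close>

lemma le_sin_near_zero:
  fixes \<epsilon> :: real
  assumes "\<epsilon> > 0"
  obtains \<eta> where "\<eta> > 0" "\<And>x. 0 \<le> x \<Longrightarrow> x \<le> pi / 2 \<Longrightarrow> sin x < \<eta> \<Longrightarrow> x \<le> (1 + \<epsilon>) * sin x"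
proof -
  have "(\<lambda>x::real. sin x / x) \<midarrow>0\<rightarrow> 1"
    using DERIV_sin[of "0::real"] by (simp add: has_field_derivative_iff)
  \<comment> \<open>With this tolerance the limit yields
    \<open>sin x / x \<ge> 1 / (1 + \<epsilon>)\<close>.\<close>
  moreover have "1 - 1 / (1 + \<epsilon>) > 0"
    using assms by simp
  ultimately obtain \<xi> where \<xi>: "\<xi> > 0"
    "\<And>x. x \<noteq> 0 \<Longrightarrow> \<bar>x\<bar> < \<xi> \<Longrightarrow> \<bar>sin x / x - 1\<bar> < 1 - 1 / (1 + \<epsilon>)"
    unfolding LIM_def by (metis (no_types, lifting) diff_zero dist_real_def)
  define m where "m = min \<xi> (pi / 2)"
  have m: "0 < m" "m \<le> pi / 2" "m \<le> \<xi>"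
    using \<xi>(1) by (auto simp: m_def)
  show ?thesis
  proof (rule that)
    show "sin m > 0" using m pi_gt_zero by (intro sin_gt_zero) linarith+
    fix x :: real assume x: "0 \<le> x" "x \<le> pi / 2" "sin x < sin m"
    have "x < m"
      using sin_mono_less_eq[of x m] x m by simp
    show "x \<le> (1 + \<epsilon>) * sin x"
    proof (cases "x = 0")
      case False
      hence "1 / (1 + \<epsilon>) \<le> sin x / x"
        using \<xi>(2)[of x] x(1) \<open>x < m\<close> m(3) by linarith
      thus ?thesis
        using False x(1) assms by (simp add: field_simps)
    qed simp
  qed
qed

section \<open>Cylindrical coordinates and the angle between half-planes\<close>

lemma point_eq_iff: "X = Y \<longleftrightarrow> X$1 = Y$1 \<and> X$2 = Y$2 \<and> X$3 = Y$3" for X Y :: point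
  by (simp add: vec_eq_iff forall_3)

lemma dist_point_sq: "(dist X Y)\<^sup>2 = (X$1 - Y$1)\<^sup>2 + (X$2 - Y$2)\<^sup>2 + (X$3 - Y$3)\<^sup>2" for X Y :: point
  unfolding dist_norm power2_norm_eq_inner inner_vec_def sum_3 by (simp add: power2_eq_square)

lemma norm_point_sq: "(norm X)\<^sup>2 = (X$1)\<^sup>2 + (X$2)\<^sup>2 + (X$3)\<^sup>2" for X :: point
  unfolding power2_norm_eq_inner inner_vec_def sum_3 by (simp add: power2_eq_square)

lemma cyl_nth [simp]: "cyl r t z $ 1 = r * cos t" "cyl r t z $ 2 = r * sin t" "cyl r t z $ 3 = z"
  by (simp_all add: cyl_def)

lemma radius_nonneg [simp]: "radius X \<ge> 0"
  by (simp add: radius_def)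

lemma radius_sq: "(radius X)\<^sup>2 = (X$1)\<^sup>2 + (X$2)\<^sup>2"
  by (simp add: radius_def)

lemma radius_cyl: "radius (cyl r t z) = \<bar>r\<bar>"
proof -
  have "(r * cos t)\<^sup>2 + (r * sin t)\<^sup>2 = r\<^sup>2"
    by (simp add: power_mult_distrib flip: distrib_left)
  thus ?thesis by (simp add: radius_def)
qed

lemma axial_iff: "axial X \<longleftrightarrow> radius X = 0"
  by (simp add: revolution_axis_def)

lemma radius_eq_0: "radius X = 0 \<longleftrightarrow> X$1 = 0 \<and> X$2 = 0"
  by (simp add: radius_def)

lemma continuous_on_radius: "continuous_on S radius"
  unfolding radius_def by (intro continuous_intros)

lemma point_eq_cyl: obtains t where "X = cyl (radius X) t (X$3)"
proof -
  obtain t where "Complex (X$1) (X$2) = of_real (radius X) * cis t"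
    using rcis_cmod_Arg[of "Complex (X$1) (X$2)"]
    by (metis cmod_def complex.sel radius_def rcis_def)
  hence "X$1 = radius X * cos t" "X$2 = radius X * sin t"
    by (auto simp: complex_eq_iff)
  thus ?thesis by (intro that[of t]) (simp add: point_eq_iff)
qed

lemma half_plane_angle_cyl:
  assumes "r > 0" "r' > 0"
  shows "half_plane_angle (cyl r t z) (cyl r' t' z') = arccos (cos (t - t'))"
proof -
  have "r * cos t * (r' * cos t') + r * sin t * (r' * sin t') = r * r' * cos (t - t')"
    by (simp add: cos_diff algebra_simps)
  thus ?thesis
    using assms by (simp add: half_plane_angle_def radius_cyl)
qed

lemma half_plane_angle_eq:
  assumes "X = cyl (radius X) t (X$3)" "Y = cyl (radius Y) t' (Y$3)" "radius X > 0" "radius Y > 0"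
  shows "half_plane_angle X Y = arccos (cos (t - t'))"
  using half_plane_angle_cyl[OF assms(3,4), of t "X$3" t' "Y$3"] by (simp only: assms(1,2)[symmetric])

lemma half_plane_angle_bounds:
  assumes "radius X > 0" "radius Y > 0"
  shows "0 \<le> half_plane_angle X Y" "half_plane_angle X Y \<le> pi"
proof -
  obtain t t' where "X = cyl (radius X) t (X$3)" "Y = cyl (radius Y) t' (Y$3)"
    using point_eq_cyl by metis
  note * = half_plane_angle_eq[OF this assms]
  show "0 \<le> half_plane_angle X Y" "half_plane_angle X Y \<le> pi"
    unfolding * by (rule arccos_cos_bounds)+
qed

lemma half_plane_angle_self: "radius X > 0 \<Longrightarrow> half_plane_angle X X = 0"
  by (simp add: half_plane_angle_def flip: power2_eq_square radius_sq)

lemma horizontal_inner: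
  assumes "radius X > 0" "radius Y > 0"
  shows "X$1 * Y$1 + X$2 * Y$2 = radius X * radius Y * cos (half_plane_angle X Y)"
proof -
  obtain t t' where *: "X = cyl (radius X) t (X$3)" "Y = cyl (radius Y) t' (Y$3)"
    using point_eq_cyl by metis
  have xy: "X$1 = radius X * cos t" "X$2 = radius X * sin t" "Y$1 = radius Y * cos t'" "Y$2 = radius Y * sin t'"
    using arg_cong[OF *(1), of "\<lambda>v. v$1"] arg_cong[OF *(1), of "\<lambda>v. v$2"]
      arg_cong[OF *(2), of "\<lambda>v. v$1"] arg_cong[OF *(2), of "\<lambda>v. v$2"] by simp_all
  have "cos (half_plane_angle X Y) = cos (t - t')"
    unfolding half_plane_angle_eq[OF * assms] by (rule cos_arccos) auto
  thus ?thesis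
    unfolding xy by (simp add: cos_diff algebra_simps)
qed

lemma half_plane_angle_triangle:
  assumes "radius X > 0" "radius Y > 0" "radius Z > 0"
  shows "half_plane_angle X Z \<le> half_plane_angle X Y + half_plane_angle Y Z"
    and "half_plane_angle X Z + half_plane_angle X Y + half_plane_angle Y Z \<le> 2 * pi"
proof -
  obtain s t u where st: "X = cyl (radius X) s (X$3)" "Y = cyl (radius Y) t (Y$3)" "Z = cyl (radius Z) u (Z$3)"
    using point_eq_cyl by metis
  have "half_plane_angle X Z = arccos (cos ((s - t) + (t - u)))"
    using half_plane_angle_eq[OF st(1,3) assms(1,3)] by simp
  with half_plane_angle_eq[OF st(1,2) assms(1,2)] half_plane_angle_eq[OF st(2,3) assms(2,3)]
  show "half_plane_angle X Z \<le> half_plane_angle X Y + half_plane_angle Y Z"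
    "half_plane_angle X Z + half_plane_angle X Y + half_plane_angle Y Z \<le> 2 * pi"
    using arccos_cos_add_le[of "s - t" "t - u"] arccos_cos_perimeter[of "s - t" "t - u"] by linarith+
qed

lemma dist_sq_cosine_law:
  assumes "radius X > 0" "radius Y > 0"
  shows "(dist X Y)\<^sup>2 = (X$3 - Y$3)\<^sup>2 + (cosine_law (radius X) (radius Y) (half_plane_angle X Y))\<^sup>2"
proof -
  have "(cosine_law (radius X) (radius Y) (half_plane_angle X Y))\<^sup>2 =
      (radius X)\<^sup>2 + (radius Y)\<^sup>2 - 2 * (X$1 * Y$1 + X$2 * Y$2)"
    unfolding horizontal_inner[OF assms] cosine_law_sq by simp
  thus ?thesis
    unfolding dist_point_sq radius_sq by (simp add: power2_eq_square algebra_simps)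
qed

lemma dist_cosine_law:
  assumes "radius X > 0" "radius Y > 0" "X$3 = Y$3"
  shows "dist X Y = cosine_law (radius X) (radius Y) (half_plane_angle X Y)"
  using dist_sq_cosine_law[OF assms(1,2)] assms(3) cosine_law_nonneg by (simp add: power2_eq_iff_nonneg)

text \<open>Dropping the differences of height and radius and shrinking both radii to
  \<open>r\<close> leaves the chord of a circle of radius \<open>r\<close>.\<close>

lemma sin_half_angle_le_dist:
  assumes "r > 0" "radius X \<ge> r" "radius Y \<ge> r"
  shows "2 * r * sin (half_plane_angle X Y / 2) \<le> dist X Y"
proof (rule power2_le_imp_le)
  have pos: "radius X > 0" "radius Y > 0" using assms by auto
  have "r * r \<le> radius X * radius Y"
    using assms by (intro mult_mono) auto
  hence "4 * (r * r) * (sin (half_plane_angle X Y / 2))\<^sup>2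
      \<le> 4 * (radius X * radius Y) * (sin (half_plane_angle X Y / 2))\<^sup>2"
    by (intro mult_right_mono) auto
  also have "\<dots> \<le> (dist X Y)\<^sup>2"
    unfolding dist_sq_cosine_law[OF pos] cosine_law_sq_half_angle by simp
  finally show "(2 * r * sin (half_plane_angle X Y / 2))\<^sup>2 \<le> (dist X Y)\<^sup>2"
    by (simp add: power2_eq_square algebra_simps)
qed simp

text \<open>The threshold is uniform in both points because their radii are bounded below; near the
  axis a small distance says nothing about the angle.\<close>

lemma half_angle_le_sin_of_dist_small:
  fixes \<epsilon> r :: real
  assumes "\<epsilon> > 0" "r > 0"
  obtains \<eta> where "\<eta> > 0"
    "\<And>X Y. radius X \<ge> r \<Longrightarrow> radius Y \<ge> r \<Longrightarrow> dist X Y < \<eta> \<Longrightarrow>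
       half_plane_angle X Y / 2 \<le> (1 + \<epsilon>) * sin (half_plane_angle X Y / 2)"
proof -
  obtain \<eta> where \<eta>: "\<eta> > 0"
    "\<And>x. 0 \<le> x \<Longrightarrow> x \<le> pi / 2 \<Longrightarrow> sin x < \<eta> \<Longrightarrow> x \<le> (1 + \<epsilon>) * sin x"
    using le_sin_near_zero[OF assms(1)] by blast
  show ?thesis
  proof (rule that[of "2 * r * \<eta>"])
    fix X Y assume *: "radius X \<ge> r" "radius Y \<ge> r" "dist X Y < 2 * r * \<eta>"
    have "2 * r * sin (half_plane_angle X Y / 2) < 2 * r * \<eta>"
      using sin_half_angle_le_dist[OF assms(2) *(1,2)] *(3) by linarith
    hence "sin (half_plane_angle X Y / 2) < \<eta>"
      using assms(2) by simp
    thus "half_plane_angle X Y / 2 \<le> (1 + \<epsilon>) * sin (half_plane_angle X Y / 2)"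
      using half_plane_angle_bounds[of X Y] * assms(2) by (intro \<eta>(2)) auto
  qed (use \<eta>(1) assms(2) in simp)
qed

section \<open>Unrolled distances\<close>

definition cylinder_dist :: "point \<Rightarrow> point \<Rightarrow> real" where
  "cylinder_dist X Y = sqrt ((X$3 - Y$3)\<^sup>2 + (half_plane_angle X Y)\<^sup>2)"

text \<open>The unrolled and the ambient distance share the height difference, and a small angle
  exceeds its chord \<open>2 * sin (\<delta> / 2)\<close> at most by a factor near 1.\<close>

lemma cylinder_dist_le_arc_length:
  assumes "a \<le> b" "continuous_on {a..b} \<gamma>" "\<And>u. u \<in> {a..b} \<Longrightarrow> radius (\<gamma> u) = 1"
  shows "ennreal (cylinder_dist (\<gamma> a) (\<gamma> b)) \<le> arc_length \<gamma> a b"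
proof (rule arc_length_ge_calibration[where K = "{X. radius X = 1}"])
  show "cylinder_dist X X = 0" if "X \<in> {X. radius X = 1}" for X
    using that by (simp add: cylinder_dist_def half_plane_angle_self)
next
  fix X Y Z assume K: "X \<in> {X. radius X = 1}" "Y \<in> {X. radius X = 1}" "Z \<in> {X. radius X = 1}"
  have "cylinder_dist X Z \<le> sqrt (((X$3 - Y$3) + (Y$3 - Z$3))\<^sup>2 + (half_plane_angle X Y + half_plane_angle Y Z)\<^sup>2)"
    unfolding cylinder_dist_def
    using half_plane_angle_triangle(1)[of X Y Z] half_plane_angle_bounds(1)[of X Z] K
    by (auto intro: power_mono)
  also have "\<dots> \<le> cylinder_dist X Y + cylinder_dist Y Z"
    unfolding cylinder_dist_def by (rule real_sqrt_sum_squares_triangle_ineq)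
  finally show "cylinder_dist X Z \<le> cylinder_dist X Y + cylinder_dist Y Z" .
next
  fix \<epsilon> :: real assume \<epsilon>: "\<epsilon> > 0"
  obtain \<eta> where \<eta>: "\<eta> > 0"
    "\<And>X Y. radius X \<ge> 1 \<Longrightarrow> radius Y \<ge> 1 \<Longrightarrow> dist X Y < \<eta> \<Longrightarrow>
       half_plane_angle X Y / 2 \<le> (1 + \<epsilon>) * sin (half_plane_angle X Y / 2)"
    using half_angle_le_sin_of_dist_small[OF \<epsilon>, of 1] by auto
  have "cylinder_dist X Y \<le> (1 + \<epsilon>) * dist X Y" if r: "radius X = 1" "radius Y = 1" and d: "dist X Y < \<eta>" for X Y
  proof -
    let ?\<delta> = "half_plane_angle X Y"
    have "0 \<le> ?\<delta>"
      using half_plane_angle_bounds r by simp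
    hence "(?\<delta> / 2)\<^sup>2 \<le> ((1 + \<epsilon>) * sin (?\<delta> / 2))\<^sup>2"
      using \<eta>(2)[of X Y] r d by (intro power_mono) auto
    hence "?\<delta>\<^sup>2 \<le> (1 + \<epsilon>)\<^sup>2 * (4 * (sin (?\<delta> / 2))\<^sup>2)"
      by (simp add: power_mult_distrib power_divide)
    moreover have "1 * (X$3 - Y$3)\<^sup>2 \<le> (1 + \<epsilon>)\<^sup>2 * (X$3 - Y$3)\<^sup>2"
      using \<epsilon> by (intro mult_right_mono) (auto intro: one_le_power)
    ultimately have "(X$3 - Y$3)\<^sup>2 + ?\<delta>\<^sup>2 \<le> (1 + \<epsilon>)\<^sup>2 * (dist X Y)\<^sup>2"
      using r by (simp add: dist_sq_cosine_law cosine_law_sq_half_angle distrib_left)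
    hence "cylinder_dist X Y \<le> sqrt (((1 + \<epsilon>) * dist X Y)\<^sup>2)"
      unfolding cylinder_dist_def by (intro real_sqrt_le_mono) (simp add: power_mult_distrib)
    thus ?thesis using \<epsilon> by simp
  qed
  thus "\<exists>\<eta>>0. \<forall>X\<in>{X. radius X = 1}. \<forall>Y\<in>{X. radius X = 1}. dist X Y < \<eta> \<longrightarrow>
      cylinder_dist X Y \<le> (1 + \<epsilon>) * dist X Y"
    using \<eta>(1) by auto
qed (use assms in auto)

text \<open>The circle at slant distance \<open>m\<close> from the cone point has radius
  \<open>m * sin \<phi>\<close>, so unrolling keeps slant distances and multiplies angles by
  \<open>sin \<phi>\<close>.\<close>

definition cone_dist :: "real \<Rightarrow> point \<Rightarrow> point \<Rightarrow> real" where
  "cone_dist \<phi> X Y = cosine_law (norm X) (norm Y) (sin \<phi> * half_plane_angle X Y)"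

text \<open>The infinite cone in terms of the slant distance \<open>norm X\<close>, the radial
  coordinate after unrolling; the cutoff at the lid becomes a separate bound on
  \<open>norm X\<close>.\<close>

definition on_cone :: "real \<Rightarrow> point \<Rightarrow> bool" where
  "on_cone \<phi> X \<longleftrightarrow> radius X = norm X * sin \<phi> \<and> X$3 = norm X * cos \<phi>"

lemma cone_dist_le_arc_length:
  assumes "a \<le> b" and cont: "continuous_on {a..b} \<gamma>" and \<phi>: "0 < \<phi>" "\<phi> < pi / 2"
    and cone: "\<And>u. u \<in> {a..b} \<Longrightarrow> on_cone \<phi> (\<gamma> u)"
  shows "ennreal (cone_dist \<phi> (\<gamma> a) (\<gamma> b)) \<le> arc_length \<gamma> a b"
proof (cases "\<exists>u\<in>{a..b}. \<gamma> u = 0")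
  case True
  then obtain u where u: "u \<in> {a..b}" "\<gamma> u = 0" by blast
  have "cone_dist \<phi> (\<gamma> a) (\<gamma> b) \<le> dist (\<gamma> a) (\<gamma> u) + dist (\<gamma> u) (\<gamma> b)"
    unfolding cone_dist_def u(2) by (simp add: cosine_law_le_add)
  hence "ennreal (cone_dist \<phi> (\<gamma> a) (\<gamma> b)) \<le> ennreal (dist (\<gamma> a) (\<gamma> u)) + ennreal (dist (\<gamma> u) (\<gamma> b))"
    by (simp flip: ennreal_plus)
  also have "\<dots> \<le> arc_length \<gamma> a u + arc_length \<gamma> u b"
    using u(1) by (intro add_mono dist_le_arc_length) auto
  also have "\<dots> = arc_length \<gamma> a b"
    using u(1) by (intro arc_length_add[symmetric]) auto
  finally show ?thesis .
next
  case False
  have s: "0 < sin \<phi>" "sin \<phi> < 1"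
    using \<phi> sin_gt_zero[of \<phi>] sin_monotone_2pi[of \<phi> "pi / 2"] by auto
  \<comment> \<open>Off the cone point the least radius along the path is positive; it is the
    \<open>r\<close> that makes the comparison of angle and chord uniform.\<close>
  have "continuous_on {a..b} (\<lambda>u. radius (\<gamma> u))"
    using continuous_on_compose2[OF continuous_on_radius cont] by blast
  then obtain u where u: "u \<in> {a..b}" "\<And>v. v \<in> {a..b} \<Longrightarrow> radius (\<gamma> u) \<le> radius (\<gamma> v)"
    using continuous_attains_inf[of "{a..b}" "\<lambda>u. radius (\<gamma> u)"] \<open>a \<le> b\<close> by fastforce
  define r where "r = radius (\<gamma> u)"
  define K where "K = {X. on_cone \<phi> X \<and> r \<le> radius X}"
  have r: "r > 0"
    using False cone[OF u(1)] u(1) s by (auto simp: r_def on_cone_def)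
  have K: "on_cone \<phi> X" "radius X > 0" "radius X \<ge> r" if "X \<in> K" for X
    using that r by (auto simp: K_def)
  show ?thesis
  proof (rule arc_length_ge_calibration[where K = K])
    show "\<gamma> ` {a..b} \<subseteq> K"
      using u cone by (auto simp: K_def r_def)
  next
    show "cone_dist \<phi> X X = 0" if "X \<in> K" for X
      using K[OF that] by (simp add: cone_dist_def half_plane_angle_self cosine_law_def power2_eq_square)
  next
    fix X Y Z assume XYZ: "X \<in> K" "Y \<in> K" "Z \<in> K"
    let ?\<alpha> = "half_plane_angle X Y" and ?\<beta> = "half_plane_angle Y Z" and ?\<delta> = "half_plane_angle X Z"
    have tri: "?\<delta> \<le> ?\<alpha> + ?\<beta>" "?\<delta> + ?\<alpha> + ?\<beta> \<le> 2 * pi" "?\<delta> \<ge> 0"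
      using half_plane_angle_triangle[of X Y Z] half_plane_angle_bounds[of X Z] K XYZ by auto
    \<comment> \<open>The scaled sum of angles may exceed pi. The perimeter bound keeps it below 2
      pi minus the scaled direct angle, where its cosine is still the smaller one.\<close>
    have "sin \<phi> * (?\<delta> + (?\<alpha> + ?\<beta>)) \<le> 1 * (2 * pi)"
      using tri s by (intro mult_mono) auto
    hence "cos (sin \<phi> * (?\<alpha> + ?\<beta>)) \<le> cos (sin \<phi> * ?\<delta>)"
      using tri s mult_left_mono[OF tri(1), of "sin \<phi>"]
      by (intro cos_le_cos_of_le) (auto simp: algebra_simps)
    hence "cone_dist \<phi> X Z \<le> cosine_law (norm X) (norm Z) (sin \<phi> * (?\<alpha> + ?\<beta>))"
      unfolding cone_dist_def by (intro cosine_law_mono) auto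
    also have "\<dots> \<le> cone_dist \<phi> X Y + cone_dist \<phi> Y Z"
      unfolding cone_dist_def distrib_left by (rule cosine_law_triangle)
    finally show "cone_dist \<phi> X Z \<le> cone_dist \<phi> X Y + cone_dist \<phi> Y Z" .
  next
    fix \<epsilon> :: real assume \<epsilon>: "\<epsilon> > 0"
    obtain \<eta> where \<eta>: "\<eta> > 0"
      "\<And>X Y. radius X \<ge> r \<Longrightarrow> radius Y \<ge> r \<Longrightarrow> dist X Y < \<eta> \<Longrightarrow>
         half_plane_angle X Y / 2 \<le> (1 + \<epsilon>) * sin (half_plane_angle X Y / 2)"
      using half_angle_le_sin_of_dist_small[OF \<epsilon> r] by blast
    have "cone_dist \<phi> X Y \<le> (1 + \<epsilon>) * dist X Y" if XY: "X \<in> K" "Y \<in> K" and d: "dist X Y < \<eta>" for X Y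
    proof -
      let ?\<delta> = "half_plane_angle X Y" and ?x = "norm X" and ?y = "norm Y"
      have \<delta>: "0 \<le> ?\<delta>"
        using half_plane_angle_bounds K XY by simp
      \<comment> \<open>Bounding the sine by its argument releases the factor
        \<open>sin \<phi>\<close>; going back from the half-angle to its sine costs
        \<open>1 + \<epsilon>\<close>.\<close>
      have "\<bar>sin (sin \<phi> * ?\<delta> / 2)\<bar> \<le> sin \<phi> * (?\<delta> / 2)"
        using abs_sin_x_le_abs_x[of "sin \<phi> * ?\<delta> / 2"] \<delta> s by simp
      also have "\<dots> \<le> sin \<phi> * ((1 + \<epsilon>) * sin (?\<delta> / 2))"
        using \<eta>(2)[of X Y] K XY d s by (intro mult_left_mono) auto
      finally have "(sin (sin \<phi> * ?\<delta> / 2))\<^sup>2 \<le> (sin \<phi> * ((1 + \<epsilon>) * sin (?\<delta> / 2)))\<^sup>2"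
        by (simp add: abs_le_square_iff[symmetric] abs_le_iff)
      hence "4 * ?x * ?y * (sin (sin \<phi> * ?\<delta> / 2))\<^sup>2 \<le> 4 * ?x * ?y * (sin \<phi> * ((1 + \<epsilon>) * sin (?\<delta> / 2)))\<^sup>2"
        by (intro mult_left_mono) auto
      hence "4 * ?x * ?y * (sin (sin \<phi> * ?\<delta> / 2))\<^sup>2 \<le>
          (1 + \<epsilon>)\<^sup>2 * (4 * ?x * ?y * (sin \<phi>)\<^sup>2 * (sin (?\<delta> / 2))\<^sup>2)"
        by (simp only: power_mult_distrib mult_ac)
      moreover have "1 * (?x - ?y)\<^sup>2 \<le> (1 + \<epsilon>)\<^sup>2 * (?x - ?y)\<^sup>2"
        using \<epsilon> by (intro mult_right_mono) (auto intro: one_le_power)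
      ultimately have "(cone_dist \<phi> X Y)\<^sup>2 \<le>
          (1 + \<epsilon>)\<^sup>2 * ((?x - ?y)\<^sup>2 + 4 * ?x * ?y * (sin \<phi>)\<^sup>2 * (sin (?\<delta> / 2))\<^sup>2)"
        by (simp add: cone_dist_def cosine_law_sq_half_angle distrib_left)
      \<comment> \<open>In space the radii are \<open>sin \<phi>\<close> times the slant distances,
        which puts \<open>(sin \<phi>)\<^sup>2\<close> into the angular part; the differences of
        height and radius recombine to the slant difference.\<close>
      also have "(?x - ?y)\<^sup>2 + 4 * ?x * ?y * (sin \<phi>)\<^sup>2 * (sin (?\<delta> / 2))\<^sup>2 = (dist X Y)\<^sup>2"
      proof -
        have diff: "X$3 - Y$3 = (?x - ?y) * cos \<phi>" "radius X - radius Y = (?x - ?y) * sin \<phi>"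
          using K(1)[OF XY(1)] K(1)[OF XY(2)] by (simp_all add: on_cone_def left_diff_distrib)
        have "(?x - ?y)\<^sup>2 = (?x - ?y)\<^sup>2 * ((cos \<phi>)\<^sup>2 + (sin \<phi>)\<^sup>2)" by simp
        also have "\<dots> = (X$3 - Y$3)\<^sup>2 + (radius X - radius Y)\<^sup>2"
          unfolding diff by (simp only: power_mult_distrib distrib_left)
        finally show ?thesis
          using K(1)[OF XY(1)] K(1)[OF XY(2)]
          unfolding dist_sq_cosine_law[OF K(2)[OF XY(1)] K(2)[OF XY(2)]] cosine_law_sq_half_angle
          by (simp add: on_cone_def power2_eq_square)
      qed
      finally show ?thesis
        using \<epsilon> by (intro power2_le_imp_le[of "cone_dist \<phi> X Y"]) (auto simp: power_mult_distrib)
    qed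
    thus "\<exists>\<eta>>0. \<forall>X\<in>K. \<forall>Y\<in>K. dist X Y < \<eta> \<longrightarrow> cone_dist \<phi> X Y \<le> (1 + \<epsilon>) * dist X Y"
      using \<eta>(1) by auto
  qed (use assms in auto)
qed

section \<open>Geodesics on the side\<close>

lemma cosine_law_cong: "cos t = cos t' \<Longrightarrow> cosine_law x y t = cosine_law x y t'"
  by (simp add: cosine_law_def)

lemma dist_cyl_sq: "(dist (cyl r t z) (cyl r' t' z'))\<^sup>2 = (z - z')\<^sup>2 + (cosine_law r r' (t - t'))\<^sup>2"
proof -
  have "(r * cos t - r' * cos t')\<^sup>2 + (r * sin t - r' * sin t')\<^sup>2 =
      r\<^sup>2 * ((sin t)\<^sup>2 + (cos t)\<^sup>2) + r'\<^sup>2 * ((sin t')\<^sup>2 + (cos t')\<^sup>2) - 2 * r * r' * cos (t - t')"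
    unfolding cos_diff by algebra
  thus ?thesis
    by (simp add: dist_point_sq cosine_law_sq)
qed

lemma point_pair_eq_cyl:
  assumes "radius X > 0" "radius Y > 0"
  obtains t \<epsilon> where "X = cyl (radius X) t (X$3)" "Y = cyl (radius Y) (t + \<epsilon> * half_plane_angle X Y) (Y$3)"
    "\<bar>\<epsilon>\<bar> = 1"
proof -
  obtain t t' where *: "X = cyl (radius X) t (X$3)" "Y = cyl (radius Y) t' (Y$3)"
    using point_eq_cyl by metis
  let ?\<delta> = "half_plane_angle X Y"
  have \<delta>: "?\<delta> = arccos (cos (t - t'))"
    by (rule half_plane_angle_eq[OF * assms])
  \<comment> \<open>The sense of a shortest turn from \<open>X\<close> to \<open>Y\<close>; when the
    sine vanishes either sense will do.\<close>
  define \<epsilon> :: real where "\<epsilon> = (if sin (t - t') \<ge> 0 then - 1 else 1)"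
  have c: "cos ?\<delta> = cos (t - t')"
    unfolding \<delta> by (rule cos_arccos) auto
  have "sin ?\<delta> = sqrt ((sin (t - t'))\<^sup>2)"
    unfolding \<delta> by (simp add: sin_arccos_abs sin_squared_eq)
  hence s: "\<epsilon> * sin ?\<delta> = - sin (t - t')"
    by (simp add: \<epsilon>_def)
  have \<epsilon>: "cos (\<epsilon> * ?\<delta>) = cos ?\<delta>" "sin (\<epsilon> * ?\<delta>) = \<epsilon> * sin ?\<delta>"
    by (simp_all add: \<epsilon>_def)
  have "cos (t + \<epsilon> * ?\<delta>) = cos (t - (t - t'))" "sin (t + \<epsilon> * ?\<delta>) = sin (t - (t - t'))"
    unfolding cos_add sin_add \<epsilon> s c cos_diff[of t "t - t'"] sin_diff[of t "t - t'"] by simp_all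
  hence "cyl (radius Y) (t + \<epsilon> * ?\<delta>) (Y$3) = cyl (radius Y) t' (Y$3)"
    by (simp add: point_eq_iff)
  with * show ?thesis
    by (intro that[of t \<epsilon>]) (auto simp: \<epsilon>_def)
qed

lemma path_of_lipschitz:
  assumes "\<And>x y. x \<in> {0..1} \<Longrightarrow> y \<in> {0..1} \<Longrightarrow> dist (\<gamma> x) (\<gamma> y) \<le> L * \<bar>x - y\<bar>" "L \<ge> 0"
  shows "path \<gamma>" "path_length \<gamma> \<le> ennreal L"
proof -
  have "L-lipschitz_on {0..1} \<gamma>"
    using assms by (intro lipschitz_onI) (auto simp: dist_real_def)
  thus "path \<gamma>"
    unfolding path_def by (rule lipschitz_on_continuous_on)
  show "path_length \<gamma> \<le> ennreal L"
    using assms(1) by (intro path_length_lipschitz_le assms(2)) (fastforce simp: abs_if split: if_splits)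
qed

text \<open>A helix: angle and height vary linearly. A chord of the unit circle is no longer than
  its arc, so the parametrization is Lipschitz with constant
  \<open>cylinder_dist X Y\<close>.\<close>

lemma cylinder_geodesic_exists:
  assumes "radius X = 1" "radius Y = 1"
  obtains \<gamma> where "path \<gamma>" "pathstart \<gamma> = X" "pathfinish \<gamma> = Y"
    "\<And>u. radius (\<gamma> u) = 1" "\<And>u. u \<in> {0..1} \<Longrightarrow> \<gamma> u $ 3 \<in> closed_segment (X$3) (Y$3)"
    "path_length \<gamma> \<le> ennreal (cylinder_dist X Y)"
proof -
  obtain t \<epsilon> where XY: "X = cyl 1 t (X$3)" "Y = cyl 1 (t + \<epsilon> * half_plane_angle X Y) (Y$3)" "\<bar>\<epsilon>\<bar> = 1"
    using point_pair_eq_cyl[of X Y] assms by auto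
  define \<delta> where "\<delta> = \<epsilon> * half_plane_angle X Y"
  define \<gamma> where "\<gamma> u = cyl 1 (t + u * \<delta>) ((1 - u) * X$3 + u * Y$3)" for u
  have "\<epsilon>\<^sup>2 = 1"
    using XY(3) by (metis one_power2 power2_abs)
  hence \<delta>: "\<delta>\<^sup>2 = (half_plane_angle X Y)\<^sup>2"
    by (simp add: \<delta>_def power_mult_distrib)
  have lip: "dist (\<gamma> u) (\<gamma> v) \<le> cylinder_dist X Y * \<bar>u - v\<bar>" for u v
  proof (rule power2_le_imp_le)
    have "\<bar>2 * sin ((u - v) * \<delta> / 2)\<bar> \<le> \<bar>(u - v) * \<delta>\<bar>"
      using abs_sin_x_le_abs_x[of "(u - v) * \<delta> / 2"] by simp
    hence "4 * (sin ((u - v) * \<delta> / 2))\<^sup>2 \<le> ((u - v) * \<delta>)\<^sup>2"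
      unfolding abs_le_square_iff by (simp add: power_mult_distrib)
    moreover have "(1 - u) * X$3 + u * Y$3 - ((1 - v) * X$3 + v * Y$3) = (u - v) * (Y$3 - X$3)"
      by (simp add: algebra_simps)
    ultimately have "(dist (\<gamma> u) (\<gamma> v))\<^sup>2 \<le> ((u - v) * (Y$3 - X$3))\<^sup>2 + ((u - v) * \<delta>)\<^sup>2"
      unfolding \<gamma>_def dist_cyl_sq cosine_law_sq_half_angle by (simp add: left_diff_distrib)
    also have "\<dots> = (cylinder_dist X Y * \<bar>u - v\<bar>)\<^sup>2"
      by (simp add: cylinder_dist_def power_mult_distrib \<delta> power2_commute[of "X$3"] distrib_left mult.commute)
    finally show "(dist (\<gamma> u) (\<gamma> v))\<^sup>2 \<le> (cylinder_dist X Y * \<bar>u - v\<bar>)\<^sup>2" .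
  qed (simp add: cylinder_dist_def)
  show ?thesis
  proof (rule that)
    show "path \<gamma>" "path_length \<gamma> \<le> ennreal (cylinder_dist X Y)"
      using lip by (rule path_of_lipschitz; simp add: cylinder_dist_def)+
    show "pathstart \<gamma> = X" "pathfinish \<gamma> = Y"
      using XY(1,2) by (simp_all add: \<gamma>_def pathstart_def pathfinish_def \<delta>_def)
    show "\<gamma> u $ 3 \<in> closed_segment (X$3) (Y$3)" if "u \<in> {0..1}" for u
      using that by (auto simp: \<gamma>_def in_segment)
  qed (simp add: \<gamma>_def radius_cyl)
qed

text \<open>The difference of the two sides vanishes at 0 and has derivative
  \<open>c * (cos (c * x) - cos x)\<close>, nonnegative on [0, pi].\<close>

lemma mult_sin_le_sin_mult:
  assumes "0 \<le> c" "c \<le> 1" "0 \<le> x" "x \<le> pi"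
  shows "c * sin x \<le> sin (c * x)"
proof -
  have "sin (c * 0) - c * sin 0 \<le> sin (c * x) - c * sin x"
  proof (rule DERIV_nonneg_imp_nondecreasing[of 0 x "\<lambda>x. sin (c * x) - c * sin x"])
    fix y assume y: "0 \<le> y" "y \<le> x"
    have "c * y \<le> 1 * y" using y assms by (intro mult_right_mono) auto
    hence "c * (cos (c * y) - cos y) \<ge> 0"
      using y assms by (intro mult_nonneg_nonneg) (auto intro!: cos_monotone_0_pi_le)
    moreover have "((\<lambda>x. sin (c * x) - c * sin x) has_real_derivative c * (cos (c * y) - cos y)) (at y)"
      by (auto intro!: derivative_eq_intros simp: algebra_simps)
    ultimately show "\<exists>d. ((\<lambda>x. sin (c * x) - c * sin x) has_real_derivative d) (at y) \<and> d \<ge> 0"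
      by blast
  qed (use assms in auto)
  thus ?thesis by simp
qed

text \<open>Needed for rolling up the plane, where an angle is divided by
  \<open>c = sin \<phi>\<close> and may become arbitrarily large; only \<open>c * x\<close> is
  bounded. Once \<open>\<bar>x\<bar>\<close> exceeds pi/2, the left side is at most
  \<open>c\<close>, and Jordan's inequality shows that the right side is at least
  \<open>c\<close>.\<close>

lemma mult_abs_sin_le_abs_sin_mult:
  assumes c: "0 < c" "c \<le> 1" and x: "\<bar>c * x\<bar> \<le> pi / 2"
  shows "c * \<bar>sin x\<bar> \<le> \<bar>sin (c * x)\<bar>"
proof -
  have nonneg: "c * \<bar>sin y\<bar> \<le> \<bar>sin (c * y)\<bar>" if y: "y \<ge> 0" "c * y \<le> pi / 2" for y
  proof (cases "y \<le> pi / 2")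
    case True
    have "sin y \<ge> 0"
      using y True by (intro sin_ge_zero) auto
    with mult_sin_le_sin_mult[of c y] c y True show ?thesis by auto
  next
    case False
    have "c * \<bar>sin y\<bar> \<le> c * 1"
      using c by (intro mult_left_mono) auto
    also have "c = 2 * (c * (pi / 2)) / pi" by simp
    also have "2 * (c * (pi / 2)) / pi \<le> 2 * (c * y) / pi"
      using False c by (intro divide_right_mono mult_left_mono) auto
    \<comment> \<open>Jordan's inequality is the preceding lemma at the point pi/2 with factor
      \<open>2 * (c * y) / pi\<close>.\<close>
    also have "2 * (c * y) / pi \<le> sin (c * y)"
      using mult_sin_le_sin_mult[of "2 * (c * y) / pi" "pi / 2"] c y by simp
    finally show ?thesis by simp
  qed
  show ?thesis
    using nonneg[of "\<bar>x\<bar>"] x c by (cases "x \<ge> 0") (auto simp: abs_mult)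
qed

lemma on_cone_cyl:
  assumes "m \<ge> 0" "0 < \<phi>" "\<phi> < pi / 2"
  shows "norm (cyl (m * sin \<phi>) t (m * cos \<phi>)) = m" "on_cone \<phi> (cyl (m * sin \<phi>) t (m * cos \<phi>))"
proof -
  have s: "sin \<phi> > 0"
    using assms by (intro sin_gt_zero) auto
  have "(norm (cyl (m * sin \<phi>) t (m * cos \<phi>)))\<^sup>2 = (radius (cyl (m * sin \<phi>) t (m * cos \<phi>)))\<^sup>2 + (m * cos \<phi>)\<^sup>2"
    by (simp only: norm_point_sq radius_sq cyl_nth)
  also have "\<dots> = m\<^sup>2 * ((sin \<phi>)\<^sup>2 + (cos \<phi>)\<^sup>2)"
    unfolding radius_cyl by (simp only: power2_abs power_mult_distrib distrib_left)
  finally show n: "norm (cyl (m * sin \<phi>) t (m * cos \<phi>)) = m"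
    using assms(1) by (simp add: power2_eq_iff_nonneg)
  show "on_cone \<phi> (cyl (m * sin \<phi>) t (m * cos \<phi>))"
    unfolding on_cone_def n radius_cyl using s assms(1) by simp
qed

text \<open>The geodesic is the image of a segment under the inverse of the unrolling of the cone,
  which is nonexpansive.\<close>

lemma cone_geodesic_exists:
  assumes \<phi>: "0 < \<phi>" "\<phi> < pi / 2" and cone: "on_cone \<phi> X" "on_cone \<phi> Y"
    and pos: "radius X > 0" "radius Y > 0"
  obtains \<gamma> where "path \<gamma>" "pathstart \<gamma> = X" "pathfinish \<gamma> = Y"
    "\<And>u. on_cone \<phi> (\<gamma> u)" "\<And>u. u \<in> {0..1} \<Longrightarrow> norm (\<gamma> u) \<le> max (norm X) (norm Y)"
    "path_length \<gamma> \<le> ennreal (cone_dist \<phi> X Y)"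
proof -
  have s: "0 < sin \<phi>" "sin \<phi> < 1"
    using \<phi> sin_gt_zero[of \<phi>] sin_monotone_2pi[of \<phi> "pi / 2"] by auto
  define x y where "x = norm X" and "y = norm Y"
  have rX: "radius X = x * sin \<phi>" "X$3 = x * cos \<phi>" and rY: "radius Y = y * sin \<phi>" "Y$3 = y * cos \<phi>"
    using cone by (auto simp: on_cone_def x_def y_def)
  have "x > 0" "y > 0"
    using pos s rX(1) rY(1) by (simp_all add: zero_less_mult_iff)
  obtain t \<epsilon> where XY: "X = cyl (radius X) t (X$3)"
    "Y = cyl (radius Y) (t + \<epsilon> * half_plane_angle X Y) (Y$3)" "\<bar>\<epsilon>\<bar> = 1"
    using point_pair_eq_cyl[OF pos] .
  define \<delta> where "\<delta> = sin \<phi> * half_plane_angle X Y"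
  have "sin \<phi> * half_plane_angle X Y \<le> 1 * half_plane_angle X Y"
    using s half_plane_angle_bounds[OF pos] by (intro mult_right_mono) auto
  hence \<delta>: "0 \<le> \<delta>" "\<delta> \<le> pi"
    using s half_plane_angle_bounds[OF pos] by (auto simp: \<delta>_def)
  \<comment> \<open>\<open>F\<close> rolls the upper half-plane onto the cone, with modulus as slant
    distance and argument divided by \<open>sin \<phi>\<close> as turn; \<open>W\<close> is the
    segment joining the unrolled endpoints.\<close>
  define F where "F w = cyl (cmod w * sin \<phi>) (t + \<epsilon> * (Arg w / sin \<phi>)) (cmod w * cos \<phi>)" for w
  define W where "W u = of_real ((1 - u) * x) + of_real (u * y) * cis \<delta>" for u
  have F_cone: "on_cone \<phi> (F w)" "norm (F w) = cmod w" for w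
    unfolding F_def using \<phi> by (auto intro: on_cone_cyl)
  have F_lip: "dist (F v) (F w) \<le> dist v w" if vw: "Im v \<ge> 0" "Im w \<ge> 0" for v w
  proof (rule power2_le_imp_le)
    let ?d = "(Arg v - Arg w) / 2"
    have "0 \<le> Arg v" "0 \<le> Arg w" "Arg v \<le> pi" "Arg w \<le> pi"
      using vw Arg_less_0 Arg_le_pi by auto
    hence "\<bar>sin \<phi> * (?d / sin \<phi>)\<bar> \<le> pi / 2"
      using s by simp
    from mult_abs_sin_le_abs_sin_mult[OF s(1) _ this] s
    have "\<bar>sin \<phi> * sin (?d / sin \<phi>)\<bar> \<le> \<bar>sin ?d\<bar>"
      by (simp add: abs_mult)
    hence "(sin \<phi>)\<^sup>2 * (sin (?d / sin \<phi>))\<^sup>2 \<le> (sin ?d)\<^sup>2"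
      unfolding abs_le_square_iff by (simp add: power_mult_distrib)
    hence le: "4 * cmod v * cmod w * ((sin \<phi>)\<^sup>2 * (sin (?d / sin \<phi>))\<^sup>2) \<le> 4 * cmod v * cmod w * (sin ?d)\<^sup>2"
      by (intro mult_left_mono) auto
    have sin_eps: "(sin (\<epsilon> * z))\<^sup>2 = (sin z)\<^sup>2" for z
      using XY(3) by (auto simp: abs_if split: if_splits)
    have half: "(t + \<epsilon> * (Arg v / sin \<phi>) - (t + \<epsilon> * (Arg w / sin \<phi>))) / 2 = \<epsilon> * (?d / sin \<phi>)"
      by (simp add: diff_divide_distrib right_diff_distrib)
    have "(dist (F v) (F w))\<^sup>2 = (cmod v * cos \<phi> - cmod w * cos \<phi>)\<^sup>2 + (cmod v * sin \<phi> - cmod w * sin \<phi>)\<^sup>2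
        + 4 * (cmod v * sin \<phi>) * (cmod w * sin \<phi>) * (sin (?d / sin \<phi>))\<^sup>2"
      unfolding F_def dist_cyl_sq cosine_law_sq_half_angle half sin_eps by simp
    also have "\<dots> = (cmod v - cmod w)\<^sup>2 * ((cos \<phi>)\<^sup>2 + (sin \<phi>)\<^sup>2)
        + 4 * cmod v * cmod w * ((sin \<phi>)\<^sup>2 * (sin (?d / sin \<phi>))\<^sup>2)"
      by (simp only: power2_eq_square left_diff_distrib[symmetric]) (simp only: distrib_left mult_ac)
    also have "\<dots> \<le> (cosine_law (cmod v) (cmod w) (Arg v - Arg w))\<^sup>2"
      unfolding cosine_law_sq_half_angle using le by simp
    also have "cosine_law (cmod v) (cmod w) (Arg v - Arg w) = cosine_law (cmod v) (cmod w) (Arg w - Arg v)"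
      by (rule cosine_law_cong) (simp add: cos_diff)
    also have "\<dots> = cmod (cis (Arg v) * (of_real (cmod v) - of_real (cmod w) * cis (Arg w - Arg v)))"
      by (simp add: cosine_law_eq_cmod norm_mult)
    also have "cis (Arg v) * (of_real (cmod v) - of_real (cmod w) * cis (Arg w - Arg v)) =
        rcis (cmod v) (Arg v) - rcis (cmod w) (Arg w)"
      by (simp add: rcis_def algebra_simps cis_mult)
    also have "\<dots> = v - w"
      by (simp add: rcis_cmod_Arg)
    finally show "(dist (F v) (F w))\<^sup>2 \<le> (dist v w)\<^sup>2"
      by (simp add: dist_norm)
  qed simp
  \<comment> \<open>Since \<open>\<delta>\<close> is at most pi, the segment stays in the closed
    upper half-plane, where arguments differ by at most pi and \<open>F_lip\<close> applies.\<close>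
  have W_Im: "Im (W u) \<ge> 0" if "u \<in> {0..1}" for u
    using that \<open>y > 0\<close> \<delta> by (auto simp: W_def intro!: mult_nonneg_nonneg sin_ge_zero)
  have lip: "dist (F (W u)) (F (W v)) \<le> cone_dist \<phi> X Y * \<bar>u - v\<bar>" if uv: "u \<in> {0..1}" "v \<in> {0..1}" for u v
  proof -
    have "W u - W v = of_real (v - u) * (of_real x - of_real y * cis \<delta>)"
      by (simp add: W_def algebra_simps)
    hence "dist (W u) (W v) = \<bar>v - u\<bar> * cmod (of_real x - of_real y * cis \<delta>)"
      by (simp only: dist_norm norm_mult norm_of_real)
    also have "cmod (of_real x - of_real y * cis \<delta>) = cone_dist \<phi> X Y"
      by (simp add: cone_dist_def cosine_law_eq_cmod x_def y_def \<delta>_def)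
    finally have "dist (W u) (W v) = cone_dist \<phi> X Y * \<bar>u - v\<bar>"
      by (simp add: abs_minus_commute)
    with F_lip[OF W_Im W_Im, OF uv] show ?thesis by simp
  qed
  show ?thesis
  proof (rule that[of "\<lambda>u. F (W u)"])
    have "cone_dist \<phi> X Y \<ge> 0"
      by (simp add: cone_dist_def cosine_law_nonneg)
    thus "path (\<lambda>u. F (W u))" "path_length (\<lambda>u. F (W u)) \<le> ennreal (cone_dist \<phi> X Y)"
      using path_of_lipschitz[of "\<lambda>u. F (W u)"] lip by blast+
    have "W 0 = of_real x"
      by (simp add: W_def)
    hence "F (W 0) = X"
      using XY(1) \<open>x > 0\<close> by (simp add: F_def rX)
    thus "pathstart (\<lambda>u. F (W u)) = X"
      by (simp add: pathstart_def)
    have "- pi < \<delta>"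
      using \<delta>(1) pi_gt_zero by linarith
    hence "W 1 = of_real y * cis \<delta>" "Arg (cis \<delta>) = \<delta>"
      using \<delta> by (auto simp: W_def intro!: Arg_cis)
    hence "F (W 1) = Y"
      using XY(2) \<open>y > 0\<close> s by (simp add: F_def rY norm_mult \<delta>_def)
    thus "pathfinish (\<lambda>u. F (W u)) = Y"
      by (simp add: pathfinish_def)
    show "norm (F (W u)) \<le> max (norm X) (norm Y)" if "u \<in> {0..1}" for u
    proof -
      have "cmod (W u) \<le> cmod (of_real ((1 - u) * x)) + cmod (of_real (u * y) * cis \<delta>)"
        unfolding W_def by (rule norm_triangle_ineq)
      also have "\<dots> = (1 - u) * x + u * y"
        using that \<open>x > 0\<close> \<open>y > 0\<close> unfolding norm_mult norm_of_real norm_cis by simp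
      also have "\<dots> \<le> (1 - u) * max x y + u * max x y"
        using that by (intro add_mono mult_left_mono) auto
      finally show ?thesis
        by (simp add: F_cone(2) x_def y_def algebra_simps)
    qed
  qed (rule F_cone)
qed

lemma in_side_cone_iff:
  assumes "0 < \<phi>" "\<phi> < pi / 2"
  shows "X \<in> side (ConicalCup \<phi>) \<longleftrightarrow> on_cone \<phi> X \<and> norm X \<le> 1 / sin \<phi>"
proof -
  have sc: "sin \<phi> > 0" "cos \<phi> > 0"
    using assms sin_gt_zero[of \<phi>] cos_gt_zero[of \<phi>] by auto
  have cone: "on_cone \<phi> X \<longleftrightarrow> radius X = X$3 * tan \<phi> \<and> 0 \<le> X$3"
  proof
    assume "on_cone \<phi> X"
    thus "radius X = X$3 * tan \<phi> \<and> 0 \<le> X$3"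
      using sc unfolding on_cone_def by (auto simp: tan_def)
  next
    assume *: "radius X = X$3 * tan \<phi> \<and> 0 \<le> X$3"
    have "(norm X)\<^sup>2 = (X$3 * tan \<phi>)\<^sup>2 + (X$3)\<^sup>2"
      using * by (simp add: norm_point_sq flip: radius_sq)
    also have "\<dots> = (X$3 / cos \<phi>)\<^sup>2 * ((sin \<phi>)\<^sup>2 + (cos \<phi>)\<^sup>2)"
      using sc by (simp only: distrib_left) (simp add: tan_def power_mult_distrib power_divide)
    finally have "norm X = X$3 / cos \<phi>"
      using * sc by (simp add: power2_eq_iff_nonneg)
    thus "on_cone \<phi> X"
      using * sc by (simp add: on_cone_def tan_def)
  qed
  have "X$3 \<le> cot \<phi> \<longleftrightarrow> norm X \<le> 1 / sin \<phi>" if "on_cone \<phi> X"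
    using that sc by (simp add: on_cone_def cot_def field_simps)
  with cone show ?thesis by auto
qed

section \<open>Crossing the rim\<close>

lemma rim_subset: assumes "is_vessel V" shows "rim V \<subseteq> side V" "rim V \<subseteq> lid V"
proof -
  have "cot \<phi> * tan \<phi> = 1" "cot \<phi> \<ge> 0" if "0 < \<phi>" "\<phi> < pi / 2" for \<phi> :: real
    using that sin_gt_zero[of \<phi>] cos_gt_zero[of \<phi>] by (auto simp: cot_def tan_def)
  with assms show "rim V \<subseteq> side V"
    by (cases V) (auto simp: rim_def)
  show "rim V \<subseteq> lid V"
    by (auto simp: rim_def lid_def)
qed

lemma side_height_bounds: "A \<in> side V \<Longrightarrow> 0 \<le> A$3 \<and> A$3 \<le> height V"
  by (cases V) auto

text \<open>Its sign tells on which side of the rim a point of the surface lies; the factor \<open>2 / height V\<close>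
  makes it negative on the base of a can and on the side of a cone alike.\<close>

definition rim_gauge :: "vessel \<Rightarrow> point \<Rightarrow> real" where
  "rim_gauge V X = 2 / height V * (X$3 - height V) + 1 - radius X"

lemma continuous_on_rim_gauge: "continuous_on S (rim_gauge V)"
  unfolding rim_gauge_def by (intro continuous_intros continuous_on_radius)

lemma rim_gauge_lid: "X \<in> lid V \<Longrightarrow> rim_gauge V X \<ge> 0 \<and> (rim_gauge V X = 0 \<longleftrightarrow> X \<in> rim V)"
  by (auto simp: rim_gauge_def lid_def rim_def)

lemma rim_gauge_side_base:
  assumes "is_vessel V" "X \<in> side V \<union> base V"
  shows "rim_gauge V X \<le> 0 \<and> (rim_gauge V X = 0 \<longrightarrow> X \<in> rim V)"
proof (cases V)
  case (SoupCan h)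
  have h: "h > 0" using assms SoupCan by simp
  have "2 / h * (X$3 - h) \<le> 0 \<and> (2 / h * (X$3 - h) = 0 \<longrightarrow> X$3 = h)" if "X$3 \<le> h"
    using that h mult_nonneg_nonpos[of "2 / h" "X$3 - h"] by auto
  \<comment> \<open>On the base the height term equals -2 and outweighs the summand 1, even at the
    axis where the radius does not help.\<close>
  moreover have "2 / h * (0 - h) = - 2" using h by simp
  ultimately show ?thesis
    using assms radius_nonneg[of X] by (auto simp: SoupCan rim_gauge_def rim_def simp del: radius_nonneg)
next
  case (ConicalCup \<phi>)
  have sc: "sin \<phi> > 0" "cos \<phi> > 0"
    using assms sin_gt_zero[of \<phi>] cos_gt_zero[of \<phi>] by (auto simp: ConicalCup)
  have t: "2 / cot \<phi> = 2 * tan \<phi>" "cot \<phi> * tan \<phi> = 1" "tan \<phi> > 0"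
    using sc by (auto simp: cot_def tan_def)
  have X: "radius X = X$3 * tan \<phi>" "X$3 \<le> cot \<phi>"
    using assms(2) by (auto simp: ConicalCup)
  \<comment> \<open>On the cone \<open>1 - radius X\<close> is
    \<open>(cot \<phi> - X$3) * tan \<phi>\<close>, which cancels one of the two copies supplied by
    the factor 2.\<close>
  have "rim_gauge V X = (X$3 - cot \<phi>) * tan \<phi>"
    using t X by (simp add: rim_gauge_def ConicalCup algebra_simps)
  moreover have "(X$3 - cot \<phi>) * tan \<phi> \<le> 0" "(X$3 - cot \<phi>) * tan \<phi> = 0 \<longleftrightarrow> X$3 = cot \<phi>"
    using t X by (auto intro: mult_nonpos_nonneg)
  ultimately show ?thesis
    using X t by (auto simp: ConicalCup rim_def)
qed

text \<open>The gauge is at most 0 at \<open>A\<close> and at least 0 at \<open>B\<close>, hence has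
  a first zero along the path. By intermediate values it is negative before that time, which
  excludes the lid; visits to the base remain possible.\<close>

lemma rim_crossing:
  assumes V: "is_vessel V" and A: "A \<in> side V" and B: "B \<in> lid V"
    and \<gamma>: "path_from_to (surface V) A B \<gamma>"
  obtains \<tau> where "\<tau> \<in> {0..1}" "\<gamma> \<tau> \<in> rim V" "\<And>u. u \<in> {0..\<tau>} \<Longrightarrow> \<gamma> u \<in> side V \<union> base V"
proof -
  let ?g = "\<lambda>u. rim_gauge V (\<gamma> u)"
  have cont: "continuous_on {0..1} \<gamma>" and ends: "\<gamma> 0 = A" "\<gamma> 1 = B"
    and in_S: "\<And>u. u \<in> {0..1} \<Longrightarrow> \<gamma> u \<in> surface V"
    using \<gamma> by (auto simp: path_from_to_def path_def pathstart_def pathfinish_def path_image_def)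
  have gcont: "continuous_on {0..1} ?g"
    using continuous_on_compose2[OF continuous_on_rim_gauge cont] by blast
  have "\<exists>u. 0 \<le> u \<and> u \<le> 1 \<and> ?g u = 0"
    using rim_gauge_side_base[OF V, of A] rim_gauge_lid[OF B] A gcont
    by (intro IVT') (auto simp: ends)
  then obtain v where v: "v \<in> {0..1}" "?g v \<in> {0}" by auto
  then obtain \<tau> where \<tau>: "\<tau> \<in> {0..1}" "?g \<tau> \<in> {0}" "\<And>w. w \<in> {0..<\<tau>} \<Longrightarrow> ?g w \<notin> {0}"
    using first_time_in_closed[OF gcont closed_singleton] by metis
  have neg: "?g u < 0" if u: "u \<in> {0..<\<tau>}" for u
  proof (rule ccontr)
    assume "\<not> ?g u < 0"
    hence "\<exists>w. 0 \<le> w \<and> w \<le> u \<and> ?g w = 0"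
      using rim_gauge_side_base[OF V, of A] A u \<tau>(1)
      by (intro IVT' continuous_on_subset[OF gcont]) (auto simp: ends)
    with \<tau>(3) u show False by fastforce
  qed
  have rim: "X \<in> rim V" if "X \<in> surface V" "rim_gauge V X = 0" for X
    using that rim_gauge_lid[of X V] rim_gauge_side_base[OF V, of X] by (auto simp: surface_def)
  show ?thesis
  proof (rule that[OF \<tau>(1)])
    show R: "\<gamma> \<tau> \<in> rim V"
      using rim in_S \<tau> by auto
    fix u assume u: "u \<in> {0..\<tau>}"
    show "\<gamma> u \<in> side V \<union> base V"
    proof (cases "u = \<tau>")
      case False
      hence "?g u < 0" "u \<in> {0..1}"
        using neg u \<tau>(1) by auto
      thus ?thesis
        using in_S[of u] rim_gauge_lid[of "\<gamma> u" V] by (auto simp: surface_def)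
    qed (use R rim_subset[OF V] in auto)
  qed
qed

lemma path_from_to_arc_length_split:
  assumes "path_from_to M A B \<gamma>" "\<tau> \<in> {0..1}"
  shows "path_length \<gamma> = arc_length \<gamma> 0 \<tau> + arc_length \<gamma> \<tau> 1"
  using assms by (simp add: path_length_eq_arc_length arc_length_add)

fun side_dist :: "vessel \<Rightarrow> point \<Rightarrow> point \<Rightarrow> real" where
  "side_dist (SoupCan h) X Y = cylinder_dist X Y"
| "side_dist (ConicalCup \<phi>) X Y = cone_dist \<phi> X Y"

lemma side_dist_le_arc_length:
  assumes "is_vessel V" "a \<le> b" "continuous_on {a..b} \<gamma>" "\<And>u. u \<in> {a..b} \<Longrightarrow> \<gamma> u \<in> side V"
  shows "ennreal (side_dist V (\<gamma> a) (\<gamma> b)) \<le> arc_length \<gamma> a b"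
proof (cases V)
  case (SoupCan h)
  have "radius (\<gamma> u) = 1" if "u \<in> {a..b}" for u
    using assms(4)[OF that] SoupCan by simp
  with cylinder_dist_le_arc_length[OF assms(2,3)] show ?thesis
    by (simp add: SoupCan)
next
  case (ConicalCup \<phi>)
  have \<phi>: "0 < \<phi>" "\<phi> < pi / 2" using assms(1) ConicalCup by auto
  have "on_cone \<phi> (\<gamma> u)" if "u \<in> {a..b}" for u
    using assms(4)[OF that] in_side_cone_iff[OF \<phi>] ConicalCup by blast
  with cone_dist_le_arc_length[OF assms(2,3) \<phi>] show ?thesis
    by (simp add: ConicalCup)
qed

lemma side_geodesic_exists:
  assumes V: "is_vessel V" and XY: "X \<in> side V" "Y \<in> side V" "radius X > 0" "radius Y > 0"
  obtains \<gamma> where "path_from_to (side V) X Y \<gamma>" "path_length \<gamma> \<le> ennreal (side_dist V X Y)"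
proof (cases V)
  case (SoupCan h)
  have r: "radius X = 1" "radius Y = 1" and z: "X$3 \<in> {0..h}" "Y$3 \<in> {0..h}"
    using XY SoupCan by auto
  obtain \<gamma> where \<gamma>: "path \<gamma>" "pathstart \<gamma> = X" "pathfinish \<gamma> = Y"
    "\<And>u. radius (\<gamma> u) = 1" "\<And>u. u \<in> {0..1} \<Longrightarrow> \<gamma> u $ 3 \<in> closed_segment (X$3) (Y$3)"
    "path_length \<gamma> \<le> ennreal (cylinder_dist X Y)"
    using cylinder_geodesic_exists[OF r] by blast
  have "closed_segment (X$3) (Y$3) \<subseteq> {0..h}"
    using z by (intro closed_segment_subset) auto
  hence "\<gamma> u \<in> side V" if "u \<in> {0..1}" for u
    using \<gamma>(4)[of u] \<gamma>(5)[OF that] by (auto simp: SoupCan)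
  hence "path_from_to (side V) X Y \<gamma>"
    using \<gamma>(1-3) by (simp add: path_from_to_def path_image_def image_subset_iff)
  with \<gamma>(6) show ?thesis by (intro that) (simp_all add: SoupCan)
next
  case (ConicalCup \<phi>)
  have \<phi>: "0 < \<phi>" "\<phi> < pi / 2" using V ConicalCup by auto
  have cone: "on_cone \<phi> X" "on_cone \<phi> Y" and n: "norm X \<le> 1 / sin \<phi>" "norm Y \<le> 1 / sin \<phi>"
    using XY in_side_cone_iff[OF \<phi>] ConicalCup by blast+
  obtain \<gamma> where \<gamma>: "path \<gamma>" "pathstart \<gamma> = X" "pathfinish \<gamma> = Y"
    "\<And>u. on_cone \<phi> (\<gamma> u)" "\<And>u. u \<in> {0..1} \<Longrightarrow> norm (\<gamma> u) \<le> max (norm X) (norm Y)"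
    "path_length \<gamma> \<le> ennreal (cone_dist \<phi> X Y)"
    using cone_geodesic_exists[OF \<phi> cone XY(3,4)] by blast
  have "\<gamma> u \<in> side V" if "u \<in> {0..1}" for u
    unfolding ConicalCup in_side_cone_iff[OF \<phi>] using \<gamma>(4,5)[of u] that n by auto
  hence "path_from_to (side V) X Y \<gamma>"
    using \<gamma>(1-3) by (simp add: path_from_to_def path_image_def image_subset_iff)
  with \<gamma>(6) show ?thesis by (intro that) (simp_all add: ConicalCup)
qed

lemma path_in_side_length_ge:
  assumes "is_vessel V" "path_from_to (side V) X Y \<gamma>"
  shows "ennreal (side_dist V X Y) \<le> path_length \<gamma>"
  using side_dist_le_arc_length[OF assms(1), of 0 1 \<gamma>] assms(2)
  by (auto simp: path_length_eq_arc_length path_from_to_def path_def path_image_def pathstart_def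
      pathfinish_def image_subset_iff)

text \<open>The explicit geodesic attains the lower bound, so every minimal path on the side has
  this length. This is why later results can speak of an arbitrary classical geodesic.\<close>

lemma minimal_side_path:
  assumes "is_vessel V" "X \<in> side V" "Y \<in> side V" "radius X > 0" "radius Y > 0"
  shows "\<exists>\<gamma>. minimal_path (side V) X Y \<gamma>"
    and "minimal_path (side V) X Y \<gamma> \<Longrightarrow> path_length \<gamma> = ennreal (side_dist V X Y)"
proof -
  obtain \<gamma>' where \<gamma>': "path_from_to (side V) X Y \<gamma>'" "path_length \<gamma>' \<le> ennreal (side_dist V X Y)"
    using side_geodesic_exists[OF assms] .
  thus "\<exists>\<gamma>. minimal_path (side V) X Y \<gamma>"
    unfolding minimal_path_def using path_in_side_length_ge[OF assms(1)] by (blast intro: order_trans)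
  assume min: "minimal_path (side V) X Y \<gamma>"
  hence "path_length \<gamma> \<le> path_length \<gamma>'"
    using \<gamma>'(1) by (auto simp: minimal_path_def)
  with \<gamma>'(2) have "path_length \<gamma> \<le> ennreal (side_dist V X Y)"
    by (rule order_trans[rotated])
  moreover have "ennreal (side_dist V X Y) \<le> path_length \<gamma>"
    using min path_in_side_length_ge[OF assms(1)] by (auto simp: minimal_path_def)
  ultimately show "path_length \<gamma> = ennreal (side_dist V X Y)"
    by (rule order_antisym)
qed

section \<open>Side legs and lid legs as functions of the crossing angle\<close>

fun rim_leg :: "vessel \<Rightarrow> point \<Rightarrow> real \<Rightarrow> real" where
  "rim_leg (SoupCan h) A t = sqrt ((h - A$3)\<^sup>2 + t\<^sup>2)"
| "rim_leg (ConicalCup \<phi>) A t = cosine_law (norm A) (1 / sin \<phi>) (t / (1 / sin \<phi>))"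

lemma rim_leg_nonneg: "rim_leg V A t \<ge> 0"
  by (cases V) (simp_all add: cosine_law_nonneg)

lemma rim_norm_cone:
  assumes "0 < \<phi>" "\<phi> < pi / 2" "R \<in> rim (ConicalCup \<phi>)"
  shows "norm R = 1 / sin \<phi>"
proof -
  have "sin \<phi> > 0" using assms sin_gt_zero[of \<phi>] by auto
  moreover have "R \<in> side (ConicalCup \<phi>)"
    using assms rim_subset(1)[of "ConicalCup \<phi>"] by auto
  hence "on_cone \<phi> R"
    using in_side_cone_iff[OF assms(1,2)] by blast
  moreover have "radius R = 1"
    using assms(3) by (simp add: rim_def)
  ultimately show ?thesis
    by (simp add: on_cone_def eq_divide_eq)
qed

lemma side_dist_rim:
  assumes "is_vessel V" "R \<in> rim V"
  shows "side_dist V A R = rim_leg V A (half_plane_angle A R)"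
  using assms rim_norm_cone[of _ R]
  by (cases V) (auto simp: cylinder_dist_def cone_dist_def rim_def power2_commute mult.commute)

text \<open>On a can the leg grows with the angle without limit, as is needed for a sum of two side
  arcs. On a cone the cosine law grows only while the scaled angle is at most pi, which
  \<open>T \<le> pi\<close> ensures.\<close>

lemma rim_leg_mono:
  assumes "is_vessel V" "0 \<le> t" "t \<le> T" "(\<exists>\<phi>. V = ConicalCup \<phi>) \<Longrightarrow> T \<le> pi"
  shows "rim_leg V A t \<le> rim_leg V A T"
proof (cases V)
  case (SoupCan h)
  thus ?thesis using assms by (auto intro!: power_mono)
next
  case (ConicalCup \<phi>)
  have s: "0 < sin \<phi>" "sin \<phi> \<le> 1" using assms ConicalCup sin_gt_zero[of \<phi>] by auto
  have "sin \<phi> * T \<le> 1 * pi"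
    using assms s ConicalCup by (intro mult_mono) auto
  hence "cos (sin \<phi> * T) \<le> cos (sin \<phi> * t)"
    using assms s by (intro cos_monotone_0_pi_le mult_left_mono) auto
  thus ?thesis
    using s by (auto simp: ConicalCup mult.commute intro!: cosine_law_mono)
qed

definition two_leg_length :: "vessel \<Rightarrow> point \<Rightarrow> real \<Rightarrow> real \<Rightarrow> real \<Rightarrow> real" where
  "two_leg_length V A b \<theta> t = rim_leg V A t + cosine_law 1 b (\<theta> - t)"

lemma continuous_on_two_leg_length: "continuous_on S (two_leg_length V A b \<theta>)"
  unfolding two_leg_length_def cosine_law_def
  by (cases V) (auto simp: cosine_law_def divide_inverse intro!: continuous_intros)

text \<open>The turns \<open>T\<close> and \<open>X\<close> only have to cover
  \<open>\<theta>\<close>. Moving the crossing back to \<open>min T \<theta>\<close> lengthens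
  neither leg: the side turn does not grow, and the turn left for the lid is at most
  \<open>X\<close>.\<close>

lemma two_leg_length_le:
  assumes V: "is_vessel V" and \<theta>: "0 \<le> \<theta>" "\<theta> \<le> T + X" and X: "0 \<le> X" "X \<le> pi"
    and T: "0 \<le> T" "(\<exists>\<phi>. V = ConicalCup \<phi>) \<Longrightarrow> T \<le> pi" and "b \<ge> 0"
  obtains t where "t \<in> {0..\<theta>}" "two_leg_length V A b \<theta> t \<le> rim_leg V A T + cosine_law 1 b X"
proof (rule that)
  show "min T \<theta> \<in> {0..\<theta>}" using T \<theta> by auto
  have "cos X \<le> cos (\<theta> - min T \<theta>)"
    using \<theta> X T by (intro cos_monotone_0_pi_le) auto
  thus "two_leg_length V A b \<theta> (min T \<theta>) \<le> rim_leg V A T + cosine_law 1 b X"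
    unfolding two_leg_length_def using \<theta> T \<open>b \<ge> 0\<close>
    by (intro add_mono cosine_law_mono rim_leg_mono[OF V]) auto
qed

text \<open>A detour over the base is traded for one over the lid: the chord \<open>Q Q'\<close> of the base is
  rotated to start at the point where the two side arcs \<open>A Q\<close> and \<open>Q' R\<close>, put
  together, end.\<close>

lemma exchange_base_chord:
  assumes pos: "radius A > 0" "radius B > 0" and one: "radius Q = 1" "radius Q' = 1" "radius R = 1"
  obtains X where "0 \<le> X" "X \<le> pi"
    "half_plane_angle A B \<le> (half_plane_angle A Q + half_plane_angle Q' R) + X"
    "cosine_law 1 (radius B) X \<le>
       cosine_law 1 1 (half_plane_angle Q Q') + cosine_law 1 (radius B) (half_plane_angle R B)"
proof -
  have r: "radius Q > 0" "radius Q' > 0" "radius R > 0" using one by auto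
  obtain a where a: "A = cyl (radius A) a (A$3)" using point_eq_cyl by blast
  obtain b where b: "B = cyl (radius B) b (B$3)" using point_eq_cyl by blast
  obtain q where q: "Q = cyl (radius Q) q (Q$3)" using point_eq_cyl by blast
  obtain q' where q': "Q' = cyl (radius Q') q' (Q'$3)" using point_eq_cyl by blast
  obtain r' where r': "R = cyl (radius R) r' (R$3)" using point_eq_cyl by blast
  \<comment> \<open>The signed turns of the base chord and of the lid leg. Signed turns about the
    axis can be added in any order, so both may follow the two side arcs.\<close>
  define x where "x = (q - q') + (r' - b)"
  have ang: "half_plane_angle A B = arccos (cos (a - b))" "half_plane_angle A Q = arccos (cos (a - q))"
    "half_plane_angle Q' R = arccos (cos (q' - r'))" "half_plane_angle Q Q' = arccos (cos (q - q'))"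
    "half_plane_angle R B = arccos (cos (r' - b))"
    using half_plane_angle_eq[OF a b pos] half_plane_angle_eq[OF a q pos(1) r(1)]
      half_plane_angle_eq[OF q' r' r(2,3)] half_plane_angle_eq[OF q q' r(1,2)]
      half_plane_angle_eq[OF r' b r(3) pos(2)] .
  have law: "cosine_law u v (arccos (cos t)) = cosine_law u v t" for u v t
    by (rule cosine_law_cong) (rule cos_arccos, auto)
  show ?thesis
  proof (rule that)
    show "0 \<le> arccos (cos x)" "arccos (cos x) \<le> pi"
      by (rule arccos_cos_bounds)+
    have "arccos (cos (a - b)) = arccos (cos ((a - q) + ((q' - r') + x)))"
      by (simp add: x_def)
    thus "half_plane_angle A B \<le> (half_plane_angle A Q + half_plane_angle Q' R) + arccos (cos x)"
      unfolding ang using arccos_cos_add_le[of "a - q" "(q' - r') + x"] arccos_cos_add_le[of "q' - r'" x]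
      by linarith
    show "cosine_law 1 (radius B) (arccos (cos x)) \<le>
       cosine_law 1 1 (half_plane_angle Q Q') + cosine_law 1 (radius B) (half_plane_angle R B)"
      unfolding ang law x_def by (rule cosine_law_triangle)
  qed
qed

lemma path_to_rim_ge:
  assumes V: "is_vessel V" and A: "A \<in> side V" "radius A > 0" and B: "B \<in> lid V" "radius B > 0"
    and \<tau>: "0 \<le> \<tau>" and cont: "continuous_on {0..\<tau>} \<gamma>" and ends: "\<gamma> 0 = A" "\<gamma> \<tau> \<in> rim V"
    and body: "\<And>u. u \<in> {0..\<tau>} \<Longrightarrow> \<gamma> u \<in> side V \<union> base V"
  obtains t where "t \<in> {0..half_plane_angle A B}"
    "ennreal (two_leg_length V A (radius B) (half_plane_angle A B) t) \<le>
       arc_length \<gamma> 0 \<tau> + ennreal (dist (\<gamma> \<tau>) B)"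
proof -
  note result = that
  define R where "R = \<gamma> \<tau>"
  let ?\<theta> = "half_plane_angle A B" and ?b = "radius B"
  have R: "R \<in> rim V" "radius R = 1" "R$3 = B$3"
    using ends(2) B(1) by (auto simp: R_def rim_def lid_def)
  have RB: "dist R B = cosine_law 1 ?b (half_plane_angle R B)"
    using dist_cosine_law[of R B] R B by simp
  have \<theta>: "0 \<le> ?\<theta>"
    using half_plane_angle_bounds A B by auto
  \<comment> \<open>It suffices to find a turn \<open>T\<close> on the side and a turn
    \<open>X\<close> on the lid that together cover the angle from \<open>A\<close> to
    \<open>B\<close> and cost no more than the path.\<close>
  have goal: thesis if TX: "?\<theta> \<le> T + X" "0 \<le> X" "X \<le> pi" "0 \<le> T" "(\<exists>\<phi>. V = ConicalCup \<phi>) \<Longrightarrow> T \<le> pi"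
    and le: "ennreal (rim_leg V A T + cosine_law 1 ?b X) \<le> arc_length \<gamma> 0 \<tau> + ennreal (dist R B)" for T X
  proof -
    obtain t where "t \<in> {0..?\<theta>}" "two_leg_length V A ?b ?\<theta> t \<le> rim_leg V A T + cosine_law 1 ?b X"
      using two_leg_length_le[OF V \<theta> TX radius_nonneg] by blast
    thus thesis
      using order_trans[OF ennreal_leI le] by (intro result[of t]) (simp_all add: R_def)
  qed
  show thesis
  proof (cases "\<forall>u\<in>{0..\<tau>}. \<gamma> u \<in> side V")
    case True
    hence "ennreal (rim_leg V A (half_plane_angle A R)) \<le> arc_length \<gamma> 0 \<tau>"
      using side_dist_le_arc_length[OF V \<tau> cont] ends side_dist_rim[OF V R(1)] by (simp add: R_def)
    hence "ennreal (rim_leg V A (half_plane_angle A R) + cosine_law 1 ?b (half_plane_angle R B))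
        \<le> arc_length \<gamma> 0 \<tau> + ennreal (dist R B)"
      by (simp add: RB add_right_mono rim_leg_nonneg cosine_law_nonneg)
    thus thesis
      using half_plane_angle_triangle(1)[of A R B] half_plane_angle_bounds[of A R] half_plane_angle_bounds[of R B]
        A B R by (intro goal) auto
  next
    case False
    then obtain v where v: "v \<in> {0..\<tau>}" "\<gamma> v \<in> base V"
      using body by blast
    then obtain h where Vh: "V = SoupCan h"
      by (cases V) auto
    have h: "h > 0" using V Vh by simp
    \<comment> \<open>The plane of the base stands in for the base: it is closed, and off it every
      point of the path up to the rim has radius 1. Between the first and last visits only the chord
      is counted.\<close>
    define Z :: "point set" where "Z = {X. X$3 = 0}"
    have Z: "closed Z"
      unfolding Z_def by (intro closed_Collect_eq continuous_intros)
    have vZ: "\<gamma> v \<in> Z"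
      using v by (simp add: Vh Z_def)
    have off_Z: "radius (\<gamma> u) = 1" if "u \<in> {0..\<tau>}" "\<gamma> u \<notin> Z" for u
      using body[OF that(1)] that(2) by (auto simp: Vh Z_def)
    obtain u1 where u1: "u1 \<in> {0..\<tau>}" "\<gamma> u1 \<in> Z" "\<And>w. w \<in> {0..<u1} \<Longrightarrow> \<gamma> w \<notin> Z"
      using first_time_in_closed[OF cont Z v(1) vZ] by blast
    obtain u2 where u2: "u2 \<in> {0..\<tau>}" "\<gamma> u2 \<in> Z" "\<And>w. w \<in> {u2<..\<tau>} \<Longrightarrow> \<gamma> w \<notin> Z"
      using last_time_in_closed[OF cont Z v(1) vZ] by blast
    have "u1 \<le> u2"
      using u1 u2 by (metis atLeastLessThan_iff atLeastAtMost_iff linorder_not_less)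
    have "R \<notin> Z"
      using R(1) h by (auto simp: Vh rim_def Z_def)
    hence "u2 < \<tau>"
      using u2(1,2) by (cases "u2 = \<tau>") (auto simp: R_def)
    have closed1: "closed {X. radius X = 1}"
      by (intro closed_Collect_eq continuous_on_radius continuous_intros)
    \<comment> \<open>The radius is 1 strictly before \<open>u1\<close>, and closedness carries this
      to \<open>u1\<close>. If \<open>u1 = 0\<close> there is no earlier time, but then the point is
      \<open>A\<close>, which lies on the side.\<close>
    have one1: "radius (\<gamma> u) = 1" if "u \<in> {0..u1}" for u
    proof (cases "u1 = 0")
      case True
      thus ?thesis using that ends A by (auto simp: Vh)
    next
      case False
      hence cl: "closure {0..<u1} = {0..u1}"
        using u1(1) by simp
      have "\<gamma> ` closure {0..<u1} \<subseteq> {X. radius X = 1}"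
        using u1 off_Z by (intro image_closure_subset closed1)
          (auto simp: cl intro!: continuous_on_subset[OF cont])
      thus ?thesis using that cl by blast
    qed
    have one2: "radius (\<gamma> u) = 1" if "u \<in> {u2..\<tau>}" for u
    proof -
      have cl: "closure {u2<..\<tau>} = {u2..\<tau>}"
        using \<open>u2 < \<tau>\<close> by simp
      have "\<gamma> ` closure {u2<..\<tau>} \<subseteq> {X. radius X = 1}"
        using u2 off_Z by (intro image_closure_subset closed1)
          (auto simp: cl intro!: continuous_on_subset[OF cont])
      thus ?thesis using that cl by blast
    qed
    define Q Q' where "Q = \<gamma> u1" and "Q' = \<gamma> u2"
    have Q: "radius Q = 1" "Q$3 = 0" "radius Q' = 1" "Q'$3 = 0"
      using one1[of u1] one2[of u2] u1 u2 \<open>u2 < \<tau>\<close> by (auto simp: Q_def Q'_def Z_def)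
    let ?T1 = "half_plane_angle A Q" and ?T2 = "half_plane_angle Q' R"
    have T: "0 \<le> ?T1" "0 \<le> ?T2"
      using half_plane_angle_bounds A Q R by auto
    obtain X where X: "0 \<le> X" "X \<le> pi" "?\<theta> \<le> (?T1 + ?T2) + X"
      "cosine_law 1 ?b X \<le> cosine_law 1 1 (half_plane_angle Q Q') + cosine_law 1 ?b (half_plane_angle R B)"
      using exchange_base_chord[OF A(2) B(2) Q(1,3) R(2)] by blast
    \<comment> \<open>Descending to the base and climbing to the rim takes height
      \<open>A$3 + h\<close>, at least the direct \<open>h - A$3\<close>. Unrolled, the two side
      arcs form a broken line with that total height and the total turn.\<close>
    have "rim_leg V A (?T1 + ?T2) \<le> sqrt ((A$3 + h)\<^sup>2 + (?T1 + ?T2)\<^sup>2)"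
      using A(1) h by (auto simp: Vh intro!: power_mono)
    also have "\<dots> \<le> sqrt ((A$3)\<^sup>2 + ?T1\<^sup>2) + sqrt (h\<^sup>2 + ?T2\<^sup>2)"
      by (rule real_sqrt_sum_squares_triangle_ineq)
    also have "\<dots> = cylinder_dist A Q + cylinder_dist Q' R"
      using Q R(1) by (simp add: cylinder_dist_def rim_def Vh)
    finally have "rim_leg V A (?T1 + ?T2) + cosine_law 1 ?b X \<le>
        cylinder_dist A Q + dist Q Q' + cylinder_dist Q' R + dist R B"
      using X(4) dist_cosine_law[of Q Q'] Q RB by simp
    hence "ennreal (rim_leg V A (?T1 + ?T2) + cosine_law 1 ?b X) \<le>
        ennreal (cylinder_dist A Q) + ennreal (dist Q Q') + ennreal (cylinder_dist Q' R) + ennreal (dist R B)"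
      by (simp add: cylinder_dist_def ennreal_leI flip: ennreal_plus)
    also have "\<dots> \<le> arc_length \<gamma> 0 u1 + arc_length \<gamma> u1 u2 + arc_length \<gamma> u2 \<tau> + ennreal (dist R B)"
    proof (intro add_mono order_refl)
      show "ennreal (cylinder_dist A Q) \<le> arc_length \<gamma> 0 u1"
        using cylinder_dist_le_arc_length[of 0 u1 \<gamma>] continuous_on_subset[OF cont, of "{0..u1}"]
          u1(1) one1 ends(1) by (simp add: Q_def)
      show "ennreal (dist Q Q') \<le> arc_length \<gamma> u1 u2"
        unfolding Q_def Q'_def by (rule dist_le_arc_length) fact
      show "ennreal (cylinder_dist Q' R) \<le> arc_length \<gamma> u2 \<tau>"
        using cylinder_dist_le_arc_length[of u2 \<tau> \<gamma>] continuous_on_subset[OF cont, of "{u2..\<tau>}"]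
          u2(1) one2 \<open>u2 < \<tau>\<close> by (simp add: Q'_def R_def)
    qed
    also have "arc_length \<gamma> 0 u1 + arc_length \<gamma> u1 u2 + arc_length \<gamma> u2 \<tau> = arc_length \<gamma> 0 \<tau>"
      using u1(1) u2(1) \<open>u1 \<le> u2\<close> by (simp add: arc_length_add[of 0 u2 \<tau>] arc_length_add[of 0 u1 u2])
    finally show thesis
      using X T Vh by (intro goal[of "?T1 + ?T2" X]) auto
  qed
qed

lemma path_length_ge_two_leg_length:
  assumes V: "is_vessel V" and A: "A \<in> side V" "radius A > 0" and B: "B \<in> lid V" "radius B > 0"
    and \<gamma>: "path_from_to (surface V) A B \<gamma>"
  obtains t where "t \<in> {0..half_plane_angle A B}"
    "ennreal (two_leg_length V A (radius B) (half_plane_angle A B) t) \<le> path_length \<gamma>"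
proof -
  obtain \<tau> where \<tau>: "\<tau> \<in> {0..1}" "\<gamma> \<tau> \<in> rim V" "\<And>u. u \<in> {0..\<tau>} \<Longrightarrow> \<gamma> u \<in> side V \<union> base V"
    using rim_crossing[OF V A(1) B(1) \<gamma>] by blast
  have "continuous_on {0..1} \<gamma>" and ends: "\<gamma> 0 = A" "\<gamma> 1 = B"
    using \<gamma> by (auto simp: path_from_to_def path_def pathstart_def pathfinish_def)
  hence cont: "continuous_on {0..\<tau>} \<gamma>"
    using \<tau>(1) by (auto elim: continuous_on_subset)
  obtain t where t: "t \<in> {0..half_plane_angle A B}"
    "ennreal (two_leg_length V A (radius B) (half_plane_angle A B) t) \<le>
       arc_length \<gamma> 0 \<tau> + ennreal (dist (\<gamma> \<tau>) B)"
    using path_to_rim_ge[OF V A B _ cont ends(1) \<tau>(2,3)] \<tau>(1) by auto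
  note t(2)
  also have "\<dots> \<le> arc_length \<gamma> 0 \<tau> + arc_length \<gamma> \<tau> 1"
    using dist_le_arc_length[of \<tau> 1 \<gamma>] \<tau>(1) ends by (intro add_left_mono) auto
  also have "\<dots> = path_length \<gamma>"
    using path_from_to_arc_length_split[OF \<gamma> \<tau>(1)] by simp
  finally show thesis
    using t(1) that by blast
qed

lemma lid_segment_subset:
  assumes "X \<in> lid V" "Y \<in> lid V"
  shows "closed_segment X Y \<subseteq> lid V"
proof -
  have rad: "radius Z = cmod (Complex (Z$1) (Z$2))" for Z
    by (simp add: radius_def cmod_def)
  show ?thesis
  proof
    fix Z assume "Z \<in> closed_segment X Y"
    then obtain u where u: "0 \<le> u" "u \<le> 1" "Z = (1 - u) *\<^sub>R X + u *\<^sub>R Y"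
      by (auto simp: in_segment)
    have "Complex (Z$1) (Z$2) = (1 - u) *\<^sub>R Complex (X$1) (X$2) + u *\<^sub>R Complex (Y$1) (Y$2)"
      by (simp add: u(3) complex_eq_iff)
    hence "radius Z \<le> (1 - u) * radius X + u * radius Y"
      using u norm_triangle_ineq[of "(1 - u) *\<^sub>R Complex (X$1) (X$2)" "u *\<^sub>R Complex (Y$1) (Y$2)"]
      by (simp add: rad)
    also have "\<dots> \<le> (1 - u) * 1 + u * 1"
      using u assms by (intro add_mono mult_left_mono) (auto simp: lid_def)
    finally show "Z \<in> lid V"
      using assms by (simp add: lid_def u(3) algebra_simps)
  qed
qed

lemma path_from_to_joinpaths:
  assumes "path_from_to (side V) A P \<gamma>" "P \<in> lid V" "B \<in> lid V"
  shows "path_from_to (surface V) A B (\<gamma> +++ linepath P B)"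
  using assms lid_segment_subset[OF assms(2,3)]
  by (auto simp: path_from_to_def path_image_join surface_def)

lemma path_length_ge_via_rim:
  assumes V: "is_vessel V" and A: "A \<in> side V" and B: "B \<in> lid V" and \<gamma>: "path_from_to (surface V) A B \<gamma>"
  obtains \<tau> where "\<tau> \<in> {0..1}" "\<gamma> \<tau> \<in> rim V"
    "ennreal (dist A (\<gamma> \<tau>) + dist (\<gamma> \<tau>) B) \<le> path_length \<gamma>"
proof -
  obtain \<tau> where \<tau>: "\<tau> \<in> {0..1}" "\<gamma> \<tau> \<in> rim V"
    using rim_crossing[OF assms] by blast
  have ends: "\<gamma> 0 = A" "\<gamma> 1 = B"
    using \<gamma> by (auto simp: path_from_to_def pathstart_def pathfinish_def)
  have "ennreal (dist A (\<gamma> \<tau>) + dist (\<gamma> \<tau>) B) \<le> arc_length \<gamma> 0 \<tau> + arc_length \<gamma> \<tau> 1"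
    using dist_le_arc_length[of 0 \<tau> \<gamma>] dist_le_arc_length[of \<tau> 1 \<gamma>] \<tau>(1)
    by (simp add: ends add_mono)
  thus thesis
    using \<tau> that path_from_to_arc_length_split[OF \<gamma> \<tau>(1)] by simp
qed

text \<open>Every path crosses the rim at some \<open>R\<close> and is no shorter than the broken
  line through \<open>R\<close>. If the broken line through the best rim point runs on the surface,
  it is minimal without any unrolling.\<close>

lemma minimal_path_via_rim:
  assumes V: "is_vessel V" and A: "A \<in> side V" and B: "B \<in> lid V" and P: "P \<in> rim V"
    and seg: "closed_segment A P \<subseteq> side V"
    and best: "\<And>R. R \<in> rim V \<Longrightarrow> dist A P + dist P B \<le> dist A R + dist R B"
  shows "minimal_path (surface V) A B (linepath A P +++ linepath P B)"
    and "path_length (linepath A P +++ linepath P B) = ennreal (dist A P + dist P B)"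
proof -
  show len: "path_length (linepath A P +++ linepath P B) = ennreal (dist A P + dist P B)"
    by (simp add: path_length_joinpaths path_length_linepath)
  have "path_from_to (surface V) A B (linepath A P +++ linepath P B)"
    using seg P rim_subset[OF V] B by (intro path_from_to_joinpaths) (auto simp: path_from_to_def)
  moreover have "ennreal (dist A P + dist P B) \<le> path_length \<gamma>" if \<gamma>: "path_from_to (surface V) A B \<gamma>" for \<gamma>
  proof -
    obtain \<tau> where "\<tau> \<in> {0..1}" "\<gamma> \<tau> \<in> rim V" "ennreal (dist A (\<gamma> \<tau>) + dist (\<gamma> \<tau>) B) \<le> path_length \<gamma>"
      using path_length_ge_via_rim[OF V A B \<gamma>] .
    thus ?thesis
      using order_trans[OF ennreal_leI[OF best]] by blast
  qed
  ultimately show "minimal_path (surface V) A B (linepath A P +++ linepath P B)"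
    unfolding minimal_path_def len by blast
qed

section \<open>The equality case: paths as short as their chord\<close>

lemma connected_subset_segment_eq:
  fixes a b :: "'a::euclidean_space"
  assumes "connected S" "S \<subseteq> closed_segment a b" "a \<in> S" "b \<in> S"
  shows "S = closed_segment a b"
proof (rule antisym[OF assms(2)], rule subsetI)
  fix x assume "x \<in> closed_segment a b"
  then obtain u where u: "0 \<le> u" "u \<le> 1" "x = (1 - u) *\<^sub>R a + u *\<^sub>R b"
    by (auto simp: in_segment)
  have inner: "(b - a) \<bullet> ((1 - v) *\<^sub>R a + v *\<^sub>R b) = (b - a) \<bullet> a + v * ((b - a) \<bullet> (b - a))" for v
    by (simp add: inner_simps algebra_simps)
  have "(b - a) \<bullet> a \<le> (b - a) \<bullet> x" "(b - a) \<bullet> x \<le> (b - a) \<bullet> b"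
    using inner[of u] inner[of 1] u mult_right_mono[of u 1 "(b - a) \<bullet> (b - a)"] by auto
  then obtain y where y: "y \<in> S" "(b - a) \<bullet> y = (b - a) \<bullet> x"
    using connected_ivt_hyperplane[OF assms(1,3,4)] by blast
  have "y \<in> closed_segment a b"
    using y(1) assms(2) by blast
  then obtain v where v: "y = (1 - v) *\<^sub>R a + v *\<^sub>R b"
    by (auto simp: in_segment)
  have "v * ((b - a) \<bullet> (b - a)) = u * ((b - a) \<bullet> (b - a))"
    using y(2) inner[of v] inner[of u] by (simp add: v u(3))
  hence "x = y"
    by (auto simp: u(3) v)
  thus "x \<in> S" using y(1) by simp
qed

text \<open>Each point of the path gives equality in the triangle inequality and so lies between the
  endpoints; connectedness leaves no gap. This yields uniqueness of images, whatever the
  parametrization.\<close>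

lemma image_eq_segment_of_arc_length:
  fixes \<gamma> :: "real \<Rightarrow> 'a::euclidean_space"
  assumes "a \<le> b" "continuous_on {a..b} \<gamma>" "arc_length \<gamma> a b \<le> ennreal (dist (\<gamma> a) (\<gamma> b))"
  shows "\<gamma> ` {a..b} = closed_segment (\<gamma> a) (\<gamma> b)"
proof (rule connected_subset_segment_eq)
  show "connected (\<gamma> ` {a..b})"
    using assms(2) by (intro connected_continuous_image) auto
  show "\<gamma> ` {a..b} \<subseteq> closed_segment (\<gamma> a) (\<gamma> b)"
  proof clarify
    fix u assume u: "u \<in> {a..b}"
    have "ennreal (dist (\<gamma> a) (\<gamma> u) + dist (\<gamma> u) (\<gamma> b)) \<le> arc_length \<gamma> a u + arc_length \<gamma> u b"
      using dist_le_arc_length[of a u \<gamma>] dist_le_arc_length[of u b \<gamma>] u by (simp add: add_mono)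
    also have "\<dots> = arc_length \<gamma> a b"
      using u by (intro arc_length_add[symmetric]) auto
    also note assms(3)
    finally have "dist (\<gamma> a) (\<gamma> b) = dist (\<gamma> a) (\<gamma> u) + dist (\<gamma> u) (\<gamma> b)"
      using dist_triangle[of "\<gamma> a" "\<gamma> b" "\<gamma> u"] by (simp add: ennreal_le_iff del: ennreal_plus)
    thus "\<gamma> u \<in> closed_segment (\<gamma> a) (\<gamma> b)"
      by (simp add: between[symmetric] between_mem_segment[symmetric])
  qed
qed (use assms in auto)

lemma minimal_path_image_via_rim:
  assumes V: "is_vessel V" and A: "A \<in> side V" and B: "B \<in> lid V" and P: "P \<in> rim V"
    and seg: "closed_segment A P \<subseteq> side V"
    and best: "\<And>R. R \<in> rim V \<Longrightarrow> dist A P + dist P B \<le> dist A R + dist R B"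
    and strict: "\<And>R. R \<in> rim V \<Longrightarrow> dist A R + dist R B \<le> dist A P + dist P B \<Longrightarrow> R = P"
    and \<gamma>: "minimal_path (surface V) A B \<gamma>"
  shows "path_image \<gamma> = closed_segment A P \<union> closed_segment P B"
proof -
  have \<gamma>_path: "path_from_to (surface V) A B \<gamma>"
    using \<gamma> by (simp add: minimal_path_def)
  hence cont: "continuous_on {0..1} \<gamma>" and ends: "\<gamma> 0 = A" "\<gamma> 1 = B"
    by (auto simp: path_from_to_def path_def pathstart_def pathfinish_def)
  note line = minimal_path_via_rim[OF V A B P seg best]
  have le: "path_length \<gamma> \<le> ennreal (dist A P + dist P B)"
    using \<gamma> line unfolding minimal_path_def by metis
  obtain \<tau> where \<tau>: "\<tau> \<in> {0..1}" "\<gamma> \<tau> \<in> rim V" "ennreal (dist A (\<gamma> \<tau>) + dist (\<gamma> \<tau>) B) \<le> path_length \<gamma>"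
    using path_length_ge_via_rim[OF V A B \<gamma>_path] .
  from order_trans[OF \<tau>(3) le] have P_eq: "\<gamma> \<tau> = P"
    using strict[OF \<tau>(2)] by (simp add: ennreal_le_iff del: ennreal_plus)
  define x y where "x = arc_length \<gamma> 0 \<tau>" and "y = arc_length \<gamma> \<tau> 1"
  have xy: "x + y \<le> ennreal (dist A P) + ennreal (dist P B)"
    using le path_from_to_arc_length_split[OF \<gamma>_path \<tau>(1)] by (simp add: x_def y_def)
  have ge: "ennreal (dist A P) \<le> x" "ennreal (dist P B) \<le> y"
    using dist_le_arc_length[of 0 \<tau> \<gamma>] dist_le_arc_length[of \<tau> 1 \<gamma>] \<tau>(1) by (simp_all add: ends P_eq x_def y_def)
  have "x \<le> ennreal (dist A P)"
  proof -
    have "x + ennreal (dist P B) \<le> ennreal (dist A P) + ennreal (dist P B)"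
      using xy ge(2) add_left_mono order_trans by blast
    thus ?thesis by (simp add: ennreal_add_left_cancel_le add.commute[of _ "ennreal (dist P B)"])
  qed
  moreover have "y \<le> ennreal (dist P B)"
  proof -
    have "ennreal (dist A P) + y \<le> ennreal (dist A P) + ennreal (dist P B)"
      using xy ge(1) add_right_mono order_trans by blast
    thus ?thesis by (simp add: ennreal_add_left_cancel_le)
  qed
  ultimately have "\<gamma> ` {0..\<tau>} = closed_segment A P" "\<gamma> ` {\<tau>..1} = closed_segment P B"
    using image_eq_segment_of_arc_length[of 0 \<tau> \<gamma>] image_eq_segment_of_arc_length[of \<tau> 1 \<gamma>] \<tau>(1)
      continuous_on_subset[OF cont] by (auto simp: ends P_eq x_def y_def)
  moreover have "{0..1} = {0..\<tau>} \<union> {\<tau>..1}"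
    using \<tau>(1) by auto
  ultimately show ?thesis
    by (simp add: path_image_def image_Un)
qed

section \<open>Paths in a half-plane\<close>

definition rim_point :: "vessel \<Rightarrow> point \<Rightarrow> point" where
  "rim_point V Q = vector [Q$1 / radius Q, Q$2 / radius Q, height V]"

lemma rim_point_nth [simp]: "rim_point V Q $ 1 = Q$1 / radius Q" "rim_point V Q $ 2 = Q$2 / radius Q"
  "rim_point V Q $ 3 = height V"
  by (simp_all add: rim_point_def)

lemma rim_point_in_rim: "radius Q > 0 \<Longrightarrow> rim_point V Q \<in> rim V"
  by (simp add: rim_def radius_def[of "rim_point V Q"] power_divide radius_sq[symmetric]
      add_divide_distrib[symmetric])

text \<open>Makes quantitative that \<open>rim_point V Q\<close> is the rim point nearest to
  \<open>Q\<close>: the excess term gives minimality through its sign and uniqueness through its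
  vanishing only at that point.\<close>

lemma dist_rim_point_sq:
  assumes "radius Q > 0" "R \<in> rim V"
  shows "(dist Q R)\<^sup>2 = (dist Q (rim_point V Q))\<^sup>2 + radius Q * (dist (rim_point V Q) R)\<^sup>2"
proof -
  define r where "r = radius Q"
  define x y where "x = Q$1 / r" and "y = Q$2 / r"
  have r: "r > 0" and Q: "Q$1 = r * x" "Q$2 = r * y"
    using assms by (auto simp: r_def x_def y_def)
  have "r\<^sup>2 * (x\<^sup>2 + y\<^sup>2) = r\<^sup>2 * 1"
    using radius_sq[of Q] by (simp add: Q algebra_simps power_mult_distrib flip: r_def)
  hence xy: "x\<^sup>2 + y\<^sup>2 = 1" using r by simp
  have R: "(R$1)\<^sup>2 + (R$2)\<^sup>2 = 1" "R$3 = height V"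
    using assms(2) radius_sq[of R] by (auto simp: rim_def)
  have P: "rim_point V Q $ 1 = x" "rim_point V Q $ 2 = y"
    by (simp_all add: x_def y_def r_def)
  show ?thesis
    unfolding dist_point_sq P Q rim_point_nth(3) R(2) r_def[symmetric]
    using xy R(1) by simp algebra
qed

lemma dist_axial_rim:
  assumes "axial X" "R \<in> rim V" "R' \<in> rim V"
  shows "dist X R = dist X R'"
proof -
  have "(dist X S)\<^sup>2 = 1 + (X$3 - height V)\<^sup>2" if "S \<in> rim V" for S
    using assms(1) that radius_sq[of S] by (auto simp: dist_point_sq axial_iff radius_eq_0 rim_def)
  hence "(dist X R)\<^sup>2 = (dist X R')\<^sup>2"
    using assms(2,3) by simp
  thus ?thesis by (simp add: power2_eq_iff_nonneg)
qed

text \<open>Within one half-plane the radius is an affine coordinate. Hence the equations of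
  cylinder and cone persist along a segment between two side points of the same half-plane.\<close>

lemma half_plane_segment:
  assumes "X \<in> half_plane Q" "Y \<in> half_plane Q"
  shows "closed_segment X Y \<subseteq> half_plane Q"
    and "0 \<le> u \<Longrightarrow> u \<le> 1 \<Longrightarrow> radius ((1 - u) *\<^sub>R X + u *\<^sub>R Y) = (1 - u) * radius X + u * radius Y"
proof -
  obtain c d where cd: "c \<ge> 0" "X$1 = c * Q$1" "X$2 = c * Q$2" "d \<ge> 0" "Y$1 = d * Q$1" "Y$2 = d * Q$2"
    using assms by (auto simp: half_plane_def)
  have rad: "radius Z = e * radius Q" if "e \<ge> 0" "Z$1 = e * Q$1" "Z$2 = e * Q$2" for Z e
    using that by (simp add: radius_def power_mult_distrib real_sqrt_mult flip: distrib_left)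
  have Z: "((1 - u) *\<^sub>R X + u *\<^sub>R Y)$1 = ((1 - u) * c + u * d) * Q$1"
    "((1 - u) *\<^sub>R X + u *\<^sub>R Y)$2 = ((1 - u) * c + u * d) * Q$2" for u
    using cd by (simp_all add: algebra_simps)
  show "closed_segment X Y \<subseteq> half_plane Q"
  proof
    fix W assume "W \<in> closed_segment X Y"
    then obtain u where u: "0 \<le> u" "u \<le> 1" "W = (1 - u) *\<^sub>R X + u *\<^sub>R Y"
      by (auto simp: in_segment)
    have "(1 - u) * c + u * d \<ge> 0"
      using cd u by simp
    thus "W \<in> half_plane Q"
      unfolding half_plane_def u(3) using Z by blast
  qed
  assume u: "0 \<le> u" "u \<le> 1"
  have "radius ((1 - u) *\<^sub>R X + u *\<^sub>R Y) = ((1 - u) * c + u * d) * radius Q"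
    using cd u by (intro rad Z) simp
  also have "\<dots> = (1 - u) * radius X + u * radius Y"
    using rad[OF cd(1-3)] rad[OF cd(4-6)] by (simp add: algebra_simps)
  finally show "radius ((1 - u) *\<^sub>R X + u *\<^sub>R Y) = (1 - u) * radius X + u * radius Y" .
qed

lemma side_segment_subset:
  assumes "A \<in> side V" "P \<in> side V" "A \<in> half_plane Q" "P \<in> half_plane Q"
  shows "closed_segment A P \<subseteq> side V"
proof
  fix X assume "X \<in> closed_segment A P"
  then obtain u where u: "0 \<le> u" "u \<le> 1" "X = (1 - u) *\<^sub>R A + u *\<^sub>R P"
    by (auto simp: in_segment)
  have r: "radius X = (1 - u) * radius A + u * radius P"
    unfolding u(3) using assms(3,4) u(1,2) by (rule half_plane_segment(2))
  have z: "X$3 = (1 - u) * A$3 + u * P$3"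
    by (simp add: u(3))
  have "0 \<le> X$3"
    using side_height_bounds assms(1,2) u by (simp add: z)
  moreover have "X$3 \<le> (1 - u) * height V + u * height V"
    unfolding z using side_height_bounds assms(1,2) u by (intro add_mono mult_left_mono) auto
  hence "X$3 \<le> height V" by (simp add: algebra_simps)
  ultimately show "X \<in> side V"
    using assms(1,2) by (cases V) (auto simp: r z algebra_simps)
qed

lemma half_plane_self: "Q \<in> half_plane Q"
  unfolding half_plane_def by (auto intro!: exI[of _ 1])

lemma axial_in_half_plane: "axial X \<Longrightarrow> X \<in> half_plane Q"
  unfolding half_plane_def by (auto simp: axial_iff radius_eq_0 intro!: exI[of _ 0])

lemma rim_point_in_half_plane: "rim_point V Q \<in> half_plane Q"
  unfolding half_plane_def by (auto intro!: exI[of _ "1 / radius Q"])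

text \<open>An axial point is equally far from all rim points, and \<open>Q\<close> is nearest to
  \<open>rim_point V Q\<close>, so this crossing is best for both legs at once. When exactly one
  endpoint is \<open>Q\<close>, its leg is strictly longer for any other crossing, which forces
  uniqueness.\<close>

lemma minimal_path_in_half_plane:
  assumes V: "is_vessel V" and A: "A \<in> side V" and B: "B \<in> lid V" and Q: "\<not> axial Q"
    and AQ: "A = Q \<or> axial A" and BQ: "B = Q \<or> axial B"
  shows "\<exists>\<gamma>. minimal_path (surface V) A B \<gamma> \<and> path_image \<gamma> \<subseteq> half_plane Q"
    and "(A = Q) \<noteq> (B = Q) \<Longrightarrow> minimal_path (surface V) A B \<gamma> \<Longrightarrow>
      path_image \<gamma> = closed_segment A (rim_point V Q) \<union> closed_segment (rim_point V Q) B"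
proof -
  let ?P = "rim_point V Q"
  have r: "radius Q > 0"
    using Q radius_nonneg[of Q] unfolding axial_iff by linarith
  have P: "?P \<in> rim V"
    by (rule rim_point_in_rim[OF r])
  have le: "dist Q ?P \<le> dist Q R" if "R \<in> rim V" for R
  proof (rule power2_le_imp_le)
    show "(dist Q ?P)\<^sup>2 \<le> (dist Q R)\<^sup>2"
      unfolding dist_rim_point_sq[OF r that] using r by simp
  qed simp
  have eq: "R = ?P" if "R \<in> rim V" "dist Q R \<le> dist Q ?P" for R
  proof -
    have "(dist Q R)\<^sup>2 \<le> (dist Q ?P)\<^sup>2"
      using that(2) by (intro power_mono) auto
    hence "radius Q * (dist ?P R)\<^sup>2 \<le> 0"
      unfolding dist_rim_point_sq[OF r that(1)] by linarith
    with r have "dist ?P R = 0" by (simp add: mult_le_0_iff)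
    thus ?thesis by simp
  qed
  have leg: "dist X ?P \<le> dist X R" if "R \<in> rim V" "X = Q \<or> axial X" for X R
    using that(2) le[OF that(1)] dist_axial_rim[OF _ P that(1), of X] by (elim disjE) simp_all
  have best: "dist A ?P + dist ?P B \<le> dist A R + dist R B" if R: "R \<in> rim V" for R
    unfolding dist_commute[of _ B] by (intro add_mono leg R AQ BQ)
  have AP: "A \<in> half_plane Q" "B \<in> half_plane Q" "?P \<in> half_plane Q"
    using AQ BQ half_plane_self[of Q] axial_in_half_plane rim_point_in_half_plane by blast+
  have seg: "closed_segment A ?P \<subseteq> side V"
    using A P rim_subset[OF V] AP by (intro side_segment_subset[where Q = Q]) auto
  have "path_image (linepath A ?P +++ linepath ?P B) \<subseteq> half_plane Q"
    using half_plane_segment(1) AP by (simp add: path_image_join)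
  with minimal_path_via_rim(1)[OF V A B P seg best]
  show "\<exists>\<gamma>. minimal_path (surface V) A B \<gamma> \<and> path_image \<gamma> \<subseteq> half_plane Q"
    by (intro exI[of _ "linepath A ?P +++ linepath ?P B"]) simp
  assume one: "(A = Q) \<noteq> (B = Q)" and \<gamma>: "minimal_path (surface V) A B \<gamma>"
  have "R = ?P" if R: "R \<in> rim V" "dist A R + dist R B \<le> dist A ?P + dist ?P B" for R
  proof (cases "A = Q")
    case True
    hence "dist B R = dist B ?P"
      using one BQ by (intro dist_axial_rim[OF _ R(1) P]) auto
    with R(2) True show ?thesis
      by (intro eq R(1)) (simp add: dist_commute[of _ B])
  next
    case False
    hence "dist A R = dist A ?P" "B = Q"
      using one AQ by (auto intro!: dist_axial_rim[OF _ R(1) P])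
    with R(2) show ?thesis
      by (intro eq R(1)) (simp add: dist_commute[of _ Q])
  qed
  from minimal_path_image_via_rim[OF V A B P seg best this \<gamma>]
  show "path_image \<gamma> = closed_segment A ?P \<union> closed_segment ?P B" .
qed

section \<open>Frames around the axis\<close>

lemma inner_point: "X \<bullet> Y = X$1 * Y$1 + X$2 * Y$2 + X$3 * Y$3" for X Y :: point
  by (simp add: inner_vec_def sum_3)

text \<open>Heights are inner products with the unit vector of the axis, which is fixed. What
  remains of a preserved inner product is its horizontal part, and this determines radii and
  angles.\<close>

lemma axial_frame_preserves:
  assumes "orthogonal_transformation \<rho>" "\<forall>X\<in>revolution_axis. \<rho> X = X"
  shows "\<rho> X $ 3 = X $ 3" "radius (\<rho> X) = radius X" "dist (\<rho> X) (\<rho> Y) = dist X Y"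
    "half_plane_angle (\<rho> X) (\<rho> Y) = half_plane_angle X Y"
proof -
  have inner: "\<rho> X \<bullet> \<rho> Y = X \<bullet> Y" for X Y
    using assms(1) by (simp add: orthogonal_transformation_def)
  have "\<rho> (axis 3 1) = axis 3 1"
    using assms(2) by (auto simp: axial_iff radius_eq_0 axis_def)
  hence z: "\<rho> X $ 3 = X $ 3" for X
    using inner[of X "axis 3 1"] by (simp add: inner_axis)
  have h: "\<rho> X $ 1 * \<rho> Y $ 1 + \<rho> X $ 2 * \<rho> Y $ 2 = X $ 1 * Y $ 1 + X $ 2 * Y $ 2" for X Y
    using inner[of X Y] z by (simp add: inner_point)
  have r: "radius (\<rho> X) = radius X" for X
    unfolding radius_def power2_eq_square h ..
  show "\<rho> X $ 3 = X $ 3" "radius (\<rho> X) = radius X"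
    by (rule z r)+
  show "dist (\<rho> X) (\<rho> Y) = dist X Y"
    using assms(1) by (simp add: dist_norm orthogonal_transformation_linear orthogonal_transformation_norm
        flip: linear_diff)
  show "half_plane_angle (\<rho> X) (\<rho> Y) = half_plane_angle X Y"
    by (simp add: half_plane_angle_def r h)
qed

lemma positioning_exists:
  assumes "radius A > 0" "radius B > 0"
  shows "\<exists>\<rho>. positioning \<rho> (half_plane_angle A B) A B"
proof -
  let ?\<theta> = "half_plane_angle A B"
  obtain t \<epsilon> where AB: "A = cyl (radius A) t (A$3)" "B = cyl (radius B) (t + \<epsilon> * ?\<theta>) (B$3)" "\<bar>\<epsilon>\<bar> = 1"
    using point_pair_eq_cyl[OF assms] .
  \<comment> \<open>The rotation by \<open>t\<close>, preceded by the reflection of the second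
    coordinate when \<open>\<epsilon>\<close> is -1, so that the angle of \<open>B\<close> comes out
    nonnegative.\<close>
  define \<rho> :: "point \<Rightarrow> point" where
    "\<rho> X = vector [cos t * X$1 - \<epsilon> * sin t * X$2, sin t * X$1 + \<epsilon> * cos t * X$2, X$3]" for X
  have nth: "\<rho> X $ 1 = cos t * X$1 - \<epsilon> * sin t * X$2" "\<rho> X $ 2 = sin t * X$1 + \<epsilon> * cos t * X$2"
    "\<rho> X $ 3 = X$3" for X
    by (simp_all add: \<rho>_def)
  have "\<epsilon>\<^sup>2 = 1"
    using AB(3) by (metis one_power2 power2_abs)
  hence \<epsilon>: "\<epsilon> * \<epsilon> = 1" by (simp add: power2_eq_square)
  have "linear \<rho>"
    by (intro linearI) (simp_all add: point_eq_iff nth algebra_simps)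
  moreover have "\<rho> X \<bullet> \<rho> Y = X \<bullet> Y" for X Y
  proof -
    have "\<rho> X $ 1 * \<rho> Y $ 1 + \<rho> X $ 2 * \<rho> Y $ 2 =
        ((sin t)\<^sup>2 + (cos t)\<^sup>2) * (X$1 * Y$1 + (\<epsilon> * \<epsilon>) * (X$2 * Y$2))"
      unfolding nth by (simp only: power2_eq_square ring_distribs) (simp add: algebra_simps)
    thus ?thesis by (simp add: inner_point nth(3) \<epsilon>)
  qed
  ultimately have "orthogonal_transformation \<rho>"
    by (simp add: orthogonal_transformation_def)
  moreover have "\<rho> X = X" if "axial X" for X
    using that by (simp add: axial_iff radius_eq_0 point_eq_iff nth)
  moreover have eps: "cos (\<epsilon> * ?\<theta>) = cos ?\<theta>" "sin (\<epsilon> * ?\<theta>) = \<epsilon> * sin ?\<theta>"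
    using AB(3) by (auto simp: abs_if split: if_splits)
  have "\<rho> (cyl r 0 z) = cyl r t z" "\<rho> (cyl r ?\<theta> z) = cyl r (t + \<epsilon> * ?\<theta>) z" for r z
    by (simp_all add: point_eq_iff nth cos_add sin_add eps algebra_simps)
  ultimately show ?thesis
    unfolding positioning_def using AB(1,2)[symmetric] by (intro exI[of _ \<rho>]) simp
qed

lemma infdist_eqI:
  assumes "a \<in> S" "dist x a = d" "\<And>y. y \<in> S \<Longrightarrow> d \<le> dist x y"
  shows "infdist x S = d"
proof (rule antisym)
  show "infdist x S \<le> d" using infdist_le[OF assms(1), of x] assms(2) by simp
  show "d \<le> infdist x S"
    using assms by (auto simp: infdist_def intro!: cINF_greatest)
qed

lemma infdist_revolution_axis: "infdist X revolution_axis = radius X"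
proof (rule infdist_eqI)
  show "cyl 0 0 (X$3) \<in> revolution_axis"
    by (simp add: axial_iff radius_cyl)
  show "dist X (cyl 0 0 (X$3)) = radius X"
    by (rule power2_eq_imp_eq) (simp_all add: dist_point_sq radius_sq)
  fix Y assume "axial Y"
  hence "(radius X)\<^sup>2 \<le> (dist X Y)\<^sup>2"
    by (simp add: dist_point_sq radius_sq axial_iff radius_eq_0)
  thus "radius X \<le> dist X Y"
    by (rule power2_le_imp_le) simp
qed

lemma infdist_rim_can:
  assumes "A \<in> side (SoupCan h)"
  shows "infdist A (rim (SoupCan h)) = h - A$3"
proof (rule infdist_eqI)
  have A: "radius A = 1" "A$3 \<le> h" using assms by auto
  show "rim_point (SoupCan h) A \<in> rim (SoupCan h)"
    using A by (intro rim_point_in_rim) simp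
  show "dist A (rim_point (SoupCan h) A) = h - A$3"
    by (rule power2_eq_imp_eq) (use A in \<open>simp_all add: dist_point_sq power2_commute\<close>)
  fix R assume "R \<in> rim (SoupCan h)"
  hence "R$3 = h" by (simp add: rim_def)
  hence "(h - A$3)\<^sup>2 \<le> (dist A R)\<^sup>2"
    by (simp add: dist_point_sq power2_commute)
  thus "h - A$3 \<le> dist A R"
    by (rule power2_le_imp_le) simp
qed

text \<open>Since \<open>t\<close> lies in [0, pi], the angle between \<open>A\<close> and
  \<open>P\<close> is \<open>t\<close> itself, and both legs have explicit lengths in any admissible
  frame. A competing path is at least as long as \<open>l t'\<close> for some \<open>t'\<close>
  depending on it, which suffices when \<open>t\<close> minimizes \<open>l\<close>.\<close>

lemma minimal_two_leg_path:
  assumes V: "is_vessel V" and A: "A \<in> side V" "\<not> axial A" and B: "B \<in> lid V" "\<not> axial B"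
    and pos: "positioning \<rho> \<theta> A B" and \<theta>: "\<theta> = half_plane_angle A B" and t: "t \<in> {0..\<theta>}"
  defines "P \<equiv> \<rho> (cyl 1 t (height V))" and "l \<equiv> two_leg_length V A (radius B) \<theta>"
  shows "\<exists>\<gamma>1. minimal_path (side V) A P \<gamma>1"
    and "minimal_path (side V) A P \<gamma>1 \<Longrightarrow> path_length (\<gamma>1 +++ linepath P B) = ennreal (l t)"
    and "minimal_path (side V) A P \<gamma>1 \<Longrightarrow> \<forall>t'\<in>{0..\<theta>}. l t \<le> l t' \<Longrightarrow>
      minimal_path (surface V) A B (\<gamma>1 +++ linepath P B)"
proof -
  have r: "radius A > 0" "radius B > 0"
    using A(2) B(2) radius_nonneg[of A] radius_nonneg[of B] unfolding axial_iff by linarith+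
  have frame: "orthogonal_transformation \<rho>" "\<forall>X\<in>revolution_axis. \<rho> X = X"
    and A_eq: "A = \<rho> (cyl (radius A) 0 (A$3))" and B_eq: "B = \<rho> (cyl (radius B) \<theta> (B$3))"
    using pos unfolding positioning_def by blast+
  note pres = axial_frame_preserves[OF frame]
  have P: "P \<in> rim V"
    by (simp add: P_def rim_def pres(1,2) radius_cyl)
  have P_side: "P \<in> side V" "P \<in> lid V" "radius P = 1"
    using P rim_subset[OF V] by (auto simp: rim_def)
  have "0 \<le> t" "t \<le> pi"
    using t half_plane_angle_bounds[OF r] by (auto simp: \<theta>)
  have "half_plane_angle A P = half_plane_angle (\<rho> (cyl (radius A) 0 (A$3))) P"
    by (rule arg_cong[OF A_eq, of "\<lambda>X. half_plane_angle X P"])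
  also have "\<dots> = arccos (cos (0 - t))"
    unfolding P_def pres(4) using r by (intro half_plane_angle_cyl) auto
  also have "\<dots> = t"
    using \<open>0 \<le> t\<close> \<open>t \<le> pi\<close> by (simp add: arccos_cos)
  finally have leg1: "side_dist V A P = rim_leg V A t"
    using side_dist_rim[OF V P] by simp
  have "dist P B = dist P (\<rho> (cyl (radius B) \<theta> (B$3)))"
    by (rule arg_cong[OF B_eq, of "dist P"])
  also have "\<dots> = dist (cyl 1 t (height V)) (cyl (radius B) \<theta> (B$3))"
    unfolding P_def pres(3) ..
  also have "\<dots> = cosine_law 1 (radius B) (t - \<theta>)"
    by (rule power2_eq_imp_eq) (use B(1) in \<open>simp_all add: dist_cyl_sq lid_def cosine_law_nonneg\<close>)
  also have "\<dots> = cosine_law 1 (radius B) (\<theta> - t)"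
    by (rule cosine_law_cong) (simp add: cos_diff)
  finally have leg2: "dist P B = cosine_law 1 (radius B) (\<theta> - t)" .
  have "radius P > 0" using P_side by simp
  note side = minimal_side_path[OF V A(1) P_side(1) r(1) this]
  show "\<exists>\<gamma>1. minimal_path (side V) A P \<gamma>1"
    by (rule side(1))
  assume \<gamma>1: "minimal_path (side V) A P \<gamma>1"
  hence \<gamma>1_path: "path_from_to (side V) A P \<gamma>1"
    by (simp add: minimal_path_def)
  have "path_length (\<gamma>1 +++ linepath P B) = ennreal (rim_leg V A t) + ennreal (dist P B)"
    using \<gamma>1_path side(2)[OF \<gamma>1] leg1
    by (simp add: path_length_joinpaths path_length_linepath path_from_to_def)
  thus len: "path_length (\<gamma>1 +++ linepath P B) = ennreal (l t)"
    by (simp add: l_def two_leg_length_def leg2 rim_leg_nonneg cosine_law_nonneg)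
  assume min: "\<forall>t'\<in>{0..\<theta>}. l t \<le> l t'"
  have "ennreal (l t) \<le> path_length \<gamma>" if \<gamma>: "path_from_to (surface V) A B \<gamma>" for \<gamma>
  proof -
    obtain t' where "t' \<in> {0..\<theta>}" "ennreal (l t') \<le> path_length \<gamma>"
      using path_length_ge_two_leg_length[OF V A(1) r(1) B(1) r(2) \<gamma>] unfolding \<theta> l_def by blast
    thus ?thesis
      using min order_trans[OF ennreal_leI] by blast
  qed
  thus "minimal_path (surface V) A B (\<gamma>1 +++ linepath P B)"
    unfolding minimal_path_def len using path_from_to_joinpaths[OF \<gamma>1_path P_side(2) B(1)] by blast
qed

theorem proposition4:
  fixes V :: vessel and A B :: point
  assumes "is_vessel V" and "A \<in> side V" and "B \<in> lid V" and "A \<noteq> B"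
  shows
    "(axial A \<and> axial B \<longrightarrow>
       (\<forall>Q\<in>surface V. \<not> axial Q \<longrightarrow>
          (\<exists>\<gamma>. minimal_path (surface V) A B \<gamma> \<and> path_image \<gamma> \<subseteq> half_plane Q)))
   \<and> (\<forall>Q. (Q = A \<and> \<not> axial A \<and> axial B \<or> Q = B \<and> axial A \<and> \<not> axial B) \<longrightarrow>
        (\<exists>\<gamma>. minimal_path (surface V) A B \<gamma> \<and> path_image \<gamma> \<subseteq> half_plane Q) \<and>
        (\<forall>\<gamma> \<gamma>'. minimal_path (surface V) A B \<gamma> \<and> minimal_path (surface V) A B \<gamma>'
           \<longrightarrow> path_image \<gamma> = path_image \<gamma>'))
   \<and> (\<not> axial A \<and> \<not> axial B \<and> separated_by_rim V A B \<longrightarrow>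
        (let \<theta> = half_plane_angle A B; b = infdist B revolution_axis in
         (\<exists>\<rho>. positioning \<rho> \<theta> A B) \<and>
         (\<forall>\<rho>. positioning \<rho> \<theta> A B \<longrightarrow>
           (let P = (\<lambda>t. \<rho> (cyl 1 t (height V))) in
            (\<exists>l :: real \<Rightarrow> real.
               (\<forall>t\<in>{0..\<theta>}. \<exists>\<gamma>1. minimal_path (side V) A (P t) \<gamma>1) \<and>
               (\<forall>t\<in>{0..\<theta>}. \<forall>\<gamma>1. minimal_path (side V) A (P t) \<gamma>1 \<longrightarrow>
                  path_length (\<gamma>1 +++ linepath (P t) B) = ennreal (l t)) \<and>
               (\<forall>\<phi> s a. V = ConicalCup \<phi> \<and> s = 1 / sin \<phi> \<and> a = dist A 0 \<longrightarrow>
                  (\<forall>t\<in>{0..\<theta>}. l t = sqrt (a\<^sup>2 - 2 * a * s * cos (t / s) + s\<^sup>2)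
                                   + sqrt (b\<^sup>2 - 2 * b * cos (\<theta> - t) + 1))) \<and>
               (\<forall>h a. V = SoupCan h \<and> a = infdist A (rim V) \<longrightarrow>
                  (\<forall>t\<in>{0..\<theta>}. l t = sqrt (a\<^sup>2 + t\<^sup>2)
                                   + sqrt (b\<^sup>2 - 2 * b * cos (\<theta> - t) + 1))) \<and>
               (\<exists>t1\<in>{0..\<theta>}. \<forall>t\<in>{0..\<theta>}. l t1 \<le> l t) \<and>
               (\<forall>t1\<in>{0..\<theta>}. (\<forall>t\<in>{0..\<theta>}. l t1 \<le> l t) \<longrightarrow>
                  (\<forall>\<gamma>1. minimal_path (side V) A (P t1) \<gamma>1 \<longrightarrow>
                     minimal_path (surface V) A B (\<gamma>1 +++ linepath (P t1) B))))))))"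
proof -
  note V = assms(1) and A = assms(2) and B = assms(3)
  have i: "\<exists>\<gamma>. minimal_path (surface V) A B \<gamma> \<and> path_image \<gamma> \<subseteq> half_plane Q"
    if "axial A" "axial B" "\<not> axial Q" for Q
    using that by (intro minimal_path_in_half_plane(1)[OF V A B]) auto
  have ii: "(\<exists>\<gamma>. minimal_path (surface V) A B \<gamma> \<and> path_image \<gamma> \<subseteq> half_plane Q) \<and>
      (\<forall>\<gamma> \<gamma>'. minimal_path (surface V) A B \<gamma> \<and> minimal_path (surface V) A B \<gamma>' \<longrightarrow>
         path_image \<gamma> = path_image \<gamma>')"
    if Q: "Q = A \<and> \<not> axial A \<and> axial B \<or> Q = B \<and> axial A \<and> \<not> axial B" for Q
  proof -
    have *: "\<not> axial Q" "A = Q \<or> axial A" "B = Q \<or> axial B" "(A = Q) \<noteq> (B = Q)"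
      using Q assms(4) by auto
    show ?thesis
      using minimal_path_in_half_plane[OF V A B *(1-3)] *(4) by simp
  qed
  have iii: "\<exists>l :: real \<Rightarrow> real.
      (\<forall>t\<in>{0..\<theta>}. \<exists>\<gamma>1. minimal_path (side V) A (P t) \<gamma>1) \<and>
      (\<forall>t\<in>{0..\<theta>}. \<forall>\<gamma>1. minimal_path (side V) A (P t) \<gamma>1 \<longrightarrow>
         path_length (\<gamma>1 +++ linepath (P t) B) = ennreal (l t)) \<and>
      (\<forall>\<phi> s a. V = ConicalCup \<phi> \<and> s = 1 / sin \<phi> \<and> a = dist A 0 \<longrightarrow>
         (\<forall>t\<in>{0..\<theta>}. l t = sqrt (a\<^sup>2 - 2 * a * s * cos (t / s) + s\<^sup>2)
                          + sqrt (b\<^sup>2 - 2 * b * cos (\<theta> - t) + 1))) \<and>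
      (\<forall>h a. V = SoupCan h \<and> a = infdist A (rim V) \<longrightarrow>
         (\<forall>t\<in>{0..\<theta>}. l t = sqrt (a\<^sup>2 + t\<^sup>2)
                          + sqrt (b\<^sup>2 - 2 * b * cos (\<theta> - t) + 1))) \<and>
      (\<exists>t1\<in>{0..\<theta>}. \<forall>t\<in>{0..\<theta>}. l t1 \<le> l t) \<and>
      (\<forall>t1\<in>{0..\<theta>}. (\<forall>t\<in>{0..\<theta>}. l t1 \<le> l t) \<longrightarrow>
         (\<forall>\<gamma>1. minimal_path (side V) A (P t1) \<gamma>1 \<longrightarrow>
            minimal_path (surface V) A B (\<gamma>1 +++ linepath (P t1) B)))"
    if nax: "\<not> axial A" "\<not> axial B" and \<theta>: "\<theta> = half_plane_angle A B"
      and b: "b = infdist B revolution_axis" and pos: "positioning \<rho> \<theta> A B"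
      and P: "P = (\<lambda>t. \<rho> (cyl 1 t (height V)))" for \<theta> b \<rho> P
  proof -
    define l where "l = two_leg_length V A b \<theta>"
    have b': "b = radius B"
      by (simp add: b infdist_revolution_axis)
    have "0 \<le> \<theta>"
      using nax radius_nonneg[of A] radius_nonneg[of B] half_plane_angle_bounds[of A B]
      unfolding \<theta> axial_iff by linarith
    note two = minimal_two_leg_path[OF V A nax(1) B nax(2) pos \<theta>, folded b', folded l_def]
    have lid_leg: "cosine_law 1 b u = sqrt (b\<^sup>2 - 2 * b * cos u + 1)" for u
      by (simp add: cosine_law_def algebra_simps)
    show ?thesis
    proof (intro exI[of _ l] conjI ballI allI impI)
      fix \<phi> s a t assume "V = ConicalCup \<phi> \<and> s = 1 / sin \<phi> \<and> a = dist A 0"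
      thus "l t = sqrt (a\<^sup>2 - 2 * a * s * cos (t / s) + s\<^sup>2) + sqrt (b\<^sup>2 - 2 * b * cos (\<theta> - t) + 1)"
        by (auto simp: l_def two_leg_length_def lid_leg cosine_law_def algebra_simps)
    next
      fix h a t assume "V = SoupCan h \<and> a = infdist A (rim V)"
      thus "l t = sqrt (a\<^sup>2 + t\<^sup>2) + sqrt (b\<^sup>2 - 2 * b * cos (\<theta> - t) + 1)"
        using A infdist_rim_can[of A h] by (auto simp: l_def two_leg_length_def lid_leg)
    next
      \<comment> \<open>A continuous function attains its infimum on the compact interval
        [0, \<theta>], nonempty because angles between half-planes are nonnegative.\<close>
      show "\<exists>t1\<in>{0..\<theta>}. \<forall>t\<in>{0..\<theta>}. l t1 \<le> l t"
        unfolding l_def using \<open>0 \<le> \<theta>\<close> by (intro continuous_attains_inf continuous_on_two_leg_length) auto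
    qed (simp_all only: P two)
  qed
  have r: "radius X > 0" if "\<not> axial X" for X
    using that radius_nonneg[of X] unfolding axial_iff by linarith
  show ?thesis
    unfolding Let_def
  proof (intro conjI)
    show "axial A \<and> axial B \<longrightarrow> (\<forall>Q\<in>surface V. \<not> axial Q \<longrightarrow>
        (\<exists>\<gamma>. minimal_path (surface V) A B \<gamma> \<and> path_image \<gamma> \<subseteq> half_plane Q))"
      by (intro impI ballI i) simp_all
    show "\<forall>Q. (Q = A \<and> \<not> axial A \<and> axial B \<or> Q = B \<and> axial A \<and> \<not> axial B) \<longrightarrow>
        (\<exists>\<gamma>. minimal_path (surface V) A B \<gamma> \<and> path_image \<gamma> \<subseteq> half_plane Q) \<and>
        (\<forall>\<gamma> \<gamma>'. minimal_path (surface V) A B \<gamma> \<and> minimal_path (surface V) A B \<gamma>'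
           \<longrightarrow> path_image \<gamma> = path_image \<gamma>')"
      by (intro allI impI ii)
  qed (intro impI, elim conjE, rule conjI, intro positioning_exists r, assumption+,
      intro allI impI, rule iii[OF _ _ refl refl _ refl], assumption+)
qed

end
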